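(* Let $\kappa=4$. The best (smallest) constant $C_P$ such that $$\int_{\mathbb{R}}u^2\,d\nu-\Big(\int_{\mathbb{R}}u\,d\nu\Big)^2\le C_P\int_{\mathbb{R}}(u')^2\,d\nu\quad\text{for all }u\in H^1(\nu)$$ satisfies $C_P\in[\,33.58004242-2.3\times10^{-7},\ 33.58004242+2.3\times10^{-7}\,]$.
   Context: Let $V(x)=\frac{x^4}{4}-\kappa\frac{x^2}{2}$, $Z=\int_{\mathbb{R}}e^{-V(x)}dx$, and $\nu(dx)=e^{-V(x)}dx/Z$. Let $H^1(\nu)=\{u\in L^2(\nu):u'\in L^2(\nu)\}$ with $u'$ the weak derivative. *)

theory Defs
  imports "HOL-Analysis.Analysis"
begin

definition V :: "real \<Rightarrow> real \<Rightarrow> real" where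
  "V \<kappa> x = x ^ 4 / 4 - \<kappa> * x ^ 2 / 2"

definition Z :: "real \<Rightarrow> real" where
  "Z \<kappa> = integral\<^sup>L lborel (\<lambda>x. exp (- V \<kappa> x))"

definition nu :: "real \<Rightarrow> real measure" where
  "nu \<kappa> = density lborel (\<lambda>x. ennreal (exp (- V \<kappa> x) / Z \<kappa>))"

definition smooth_fun :: "(real \<Rightarrow> real) \<Rightarrow> bool" where
  "smooth_fun \<phi> \<longleftrightarrow> (\<forall>n x. ((deriv ^^ n) \<phi>) differentiable (at x))"

definition test_fun :: "(real \<Rightarrow> real) \<Rightarrow> bool" where
  "test_fun \<phi> \<longleftrightarrow> smooth_fun \<phi> \<and> compact (closure {x. \<phi> x \<noteq> 0})"

definition weak_deriv :: "(real \<Rightarrow> real) \<Rightarrow> (real \<Rightarrow> real) \<Rightarrow> bool" where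
  "weak_deriv u g \<longleftrightarrow>
     (\<forall>K. compact K \<longrightarrow> set_integrable lborel K u \<and> set_integrable lborel K g) \<and>
     (\<forall>\<phi>. test_fun \<phi> \<longrightarrow>
        (LINT x|lborel. u x * deriv \<phi> x) = - (LINT x|lborel. g x * \<phi> x))"

definition H1 :: "real measure \<Rightarrow> (real \<Rightarrow> real) \<Rightarrow> (real \<Rightarrow> real) \<Rightarrow> bool" where
  "H1 M u g \<longleftrightarrow>
     u \<in> borel_measurable borel \<and> g \<in> borel_measurable borel \<and>
     integrable M (\<lambda>x. (u x)\<^sup>2) \<and> integrable M (\<lambda>x. (g x)\<^sup>2) \<and> weak_deriv u g"

definition poincare_const :: "real measure \<Rightarrow> real \<Rightarrow> bool" where
  "poincare_const M C \<longleftrightarrow>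
     (\<forall>u g. H1 M u g \<longrightarrow>
        (LINT x|M. (u x)\<^sup>2) - (LINT x|M. u x)\<^sup>2 \<le> C * (LINT x|M. (g x)\<^sup>2))"

end

(*
  The first nontrivial eigenfunction f of L f = f'' - V' f' is odd and increasing, so both bounds reduce
  to the half-line with f 0 = 0.

  Upper bound: up to an additive constant u is a.e. the antiderivative G of its weak derivative g with
  G 0 = 0, and the variance of u is at most the integral of G^2. If F'' - V' F' + lam F <= 0 with F >= 0
  and F' > 0, then Cauchy-Schwarz with weight F' and Tonelli give the Poincare inequality on each
  half-line with constant 1 / lam.

  Lower bound: an odd test function with f'' - V' f' + lam f >= 0 on the half-line, f >= 0, that is
  constant beyond the first zero of f', has Rayleigh quotient at most lam by integration by parts.

  Solving the initial value problem with lam slightly below (above) the eigenvalue gives functions of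
  both kinds: below, f' stays positive until a linear tail can be attached; above, f' reaches zero.
  These solutions are replaced by polynomials on intervals of length 1/8, for which the differential
  inequalities follow from comparing the constant coefficient of an integer polynomial with the sum of
  the absolute values of the others.
*)
theory Submission
  imports Defs "HOL-Probability.Distributions"
begin

section \<open>The density\<close>

text \<open>The target interval has relative width about 1.4e-8, so both bounds rest on nearly exact
  solutions of the eigenvalue equation. What makes rounded data rigorous is that each bound is
  claimed for a parameter lam strictly on the safe side of the parameter 1 / C0 that the data solve:
  the exact solution f leaves the residual (lam - 1 / C0) * f, which has a fixed sign, and
  truncation and rounding may consume this margin. It is proportional to f and so degenerates only
  at 0, which is why the piece at the origin is tested differently.

  Polynomial pieces that agree in value and slope still have a jump in the second derivative at each
  joint. Both kinds of certificate are therefore stated through integrals against the density rather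
  than pointwise. These integrals extend to infinity, so a certificate is assembled from the tail
  inwards.

  The density stays unnormalised because the half-line estimates are homogeneous in the weight;
  \<open>Z 4\<close> enters only when passing to \<open>nu 4\<close>.\<close>

definition dens :: "real \<Rightarrow> real" where
  "dens x = exp (- V 4 x)"

lemma dens_pos: "0 < dens x"
  by (simp add: dens_def)

lemma dens_even: "dens (- x) = dens x"
  by (simp add: dens_def V_def)

lemma DERIV_dens: "(dens has_real_derivative - (x ^ 3 - 4 * x) * dens x) (at x)"
  unfolding dens_def V_def
  by (auto intro!: derivative_eq_intros simp: algebra_simps power2_eq_square power3_eq_cube)

lemma continuous_on_dens [continuous_intros]: "continuous_on S dens"
  by (meson DERIV_dens DERIV_continuous continuous_at_imp_continuous_on)

lemma isCont_dens: "isCont dens x"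
  by (rule DERIV_isCont[OF DERIV_dens])

lemma borel_measurable_dens [measurable]: "dens \<in> borel_measurable borel"
  by (rule borel_measurable_continuous_onI[OF continuous_on_dens])

text \<open>Completing the square in x^4 / 4 - 3 x^2 + 9 trades the quartic for a Gaussian majorant,
  from which integrability and decay at infinity follow.\<close>

lemma dens_le: "dens x \<le> exp 9 * exp (- x\<^sup>2)"
proof -
  have "0 \<le> (x\<^sup>2 / 2 - 3)\<^sup>2" by simp
  then have "- V 4 x \<le> 9 + - x\<^sup>2"
    by (simp add: V_def power2_eq_square power4_eq_xxxx field_simps)
  then show ?thesis
    unfolding dens_def by (simp flip: exp_add)
qed

lemma integrable_dens: "integrable lborel dens"
proof -
  have 1: "integrable lborel (\<lambda>x::real. indicator {0..} x *\<^sub>R exp (- x\<^sup>2))"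
    using gaussian_moment_0 by (rule integrable.intros)
  have 2: "integrable lborel (\<lambda>x::real. indicator {0..} (- x) *\<^sub>R exp (- (- x)\<^sup>2))"
    using lborel_integrable_real_affine[OF 1, of "-1" 0] by simp
  have 3: "integrable lborel (\<lambda>x::real. exp 9 * (indicator {0..} x *\<^sub>R exp (- x\<^sup>2) + indicator {0..} (- x) *\<^sub>R exp (- (- x)\<^sup>2)))"
    by (intro integrable_mult_right Bochner_Integration.integrable_add 1 2)
  show ?thesis
  proof (rule Bochner_Integration.integrable_bound[OF 3])
    show "AE x in lborel. norm (dens x) \<le> norm (exp 9 * (indicator {0..} x *\<^sub>R exp (- x\<^sup>2) + indicator {0..} (- x) *\<^sub>R exp (- (- x)\<^sup>2)))"
    proof (rule AE_I2)
      fix x :: real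
      have "dens x \<le> exp 9 * (indicator {0..} x *\<^sub>R exp (- x\<^sup>2) + indicator {0..} (- x) *\<^sub>R exp (- (- x)\<^sup>2))"
        using dens_le[of x] exp_ge_zero[of "9::real"] by (auto simp: indicator_def simp del: exp_ge_zero)
      then show "norm (dens x) \<le> norm (exp 9 * (indicator {0..} x *\<^sub>R exp (- x\<^sup>2) + indicator {0..} (- x) *\<^sub>R exp (- (- x)\<^sup>2)))"
        using dens_pos[of x] by simp
    qed
  qed simp
qed

lemma dens_tendsto_0: "(dens \<longlongrightarrow> 0) at_top"
proof (rule tendsto_sandwich)
  show "((\<lambda>_. 0) \<longlongrightarrow> 0) at_top" by simp
  show "((\<lambda>x::real. exp 9 * exp (- x)) \<longlongrightarrow> 0) at_top"
    using tendsto_mult_right_zero[OF filterlim_compose[OF exp_at_bot filterlim_uminus_at_bot_at_top], of "exp 9"] by simp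
  show "\<forall>\<^sub>F x in at_top. dens x \<le> exp 9 * exp (- x)"
    using eventually_ge_at_top[of 1]
  proof eventually_elim
    case (elim x)
    then have "x \<le> x\<^sup>2" by (simp add: power2_eq_square)
    then have "exp 9 * exp (- x\<^sup>2) \<le> exp 9 * exp (- x)" by simp
    then show ?case using dens_le[of x] by linarith
  qed
qed (simp add: dens_pos less_imp_le)

lemma Z_eq: "Z 4 = (LINT x|lborel. dens x)"
  by (simp add: Z_def dens_def)

lemma Z_pos: "0 < Z 4"
proof -
  have "(LINT x|lborel. dens x) \<noteq> 0"
  proof
    assume "(LINT x|lborel. dens x) = 0"
    then have "AE x in lborel. dens x = 0"
      using integral_nonneg_eq_0_iff_AE[OF integrable_dens] by (simp add: dens_pos less_imp_le)
    then have "AE x in lborel::real measure. False"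
      by eventually_elim (use dens_pos in \<open>metis less_irrefl\<close>)
    then show False by (simp add: eventually_False ae_filter_eq_bot_iff)
  qed
  moreover have "0 \<le> (LINT x|lborel. dens x)"
    by (simp add: dens_pos less_imp_le)
  ultimately show ?thesis by (simp add: Z_eq)
qed

section \<open>Supersolutions\<close>

text \<open>
  Read \<open>w\<close> as the derivative of \<open>F\<close> on \<open>{a..}\<close>, with \<open>F a = A\<close> and \<open>w a = B\<close>. The integrated form of
  \<open>F'' - V' F' + lam F \<le> 0\<close> is exactly what the Hardy inequality consumes, and it survives gluing at
  a point where only values and first derivatives match.
\<close>

definition supersolution :: "real \<Rightarrow> real \<Rightarrow> real \<Rightarrow> real \<Rightarrow> bool" where
  "supersolution lam a A B \<longleftrightarrow>
     (\<exists>w F. w \<in> borel_measurable borel \<and> F \<in> borel_measurable borel \<and> w a = B \<and>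
        (\<forall>x\<ge>a. 0 < w x \<and> 0 \<le> F x \<and>
           ennreal A + (\<integral>\<^sup>+t. ennreal (w t) * indicator {a..x} t \<partial>lborel) \<le> ennreal (F x) \<and>
           ennreal lam * (\<integral>\<^sup>+t. ennreal (F t * dens t) * indicator {x..} t \<partial>lborel)
             \<le> ennreal (w x * dens x)))"

text \<open>A linear F has no second derivative, so only lam * F \<le> B * V' is at stake. The
  assumption gives it at R, and it persists because V' has slope at least 1 \<ge> lam beyond 2.
  Since - B * \<open>dens\<close> has derivative B * V' * \<open>dens\<close> and vanishes at
  infinity, integration gives the tail clause.\<close>

lemma supersolution_tail:
  assumes lam: "0 \<le> lam" "lam \<le> 1" and R: "2 \<le> R" and A: "0 \<le> A" and B: "0 < B"
    and le: "lam * A \<le> B * (R ^ 3 - 4 * R)"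
  shows "supersolution lam R A B"
proof -
  define F where "F x = A + B * (x - R)" for x
  have [measurable]: "F \<in> borel_measurable borel" unfolding F_def by simp
  have cubic: "R ^ 3 - 4 * R + (x - R) \<le> x ^ 3 - 4 * x" if "R \<le> x" for x
  proof -
    have "2 * 2 \<le> R * R" "2 * 2 \<le> x * x" "2 * 2 \<le> x * R"
      using R that by (intro mult_mono; simp)+
    then have "0 \<le> (x - R) * (x * x + x * R + R * R - 5)"
      using that by (intro mult_nonneg_nonneg) auto
    then show ?thesis by (simp add: algebra_simps power3_eq_cube)
  qed
  have key: "lam * (F x * dens x) \<le> B * ((x ^ 3 - 4 * x) * dens x)" if "R \<le> x" for x
  proof -
    have "lam * (B * (x - R)) \<le> 1 * (B * (x - R))"
      using lam B that by (intro mult_right_mono) auto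
    then have "lam * F x \<le> B * (R ^ 3 - 4 * R + (x - R))"
      using le by (simp add: F_def algebra_simps)
    also have "\<dots> \<le> B * (x ^ 3 - 4 * x)"
      using cubic[OF that] B by (intro mult_left_mono) auto
    finally have "lam * F x * dens x \<le> B * (x ^ 3 - 4 * x) * dens x"
      using dens_pos by (intro mult_right_mono) (auto simp: less_imp_le)
    then show ?thesis by (simp add: mult_ac)
  qed
  have F0: "0 \<le> F x" if "R \<le> x" for x
    using that A B by (simp add: F_def)
  have tail: "ennreal lam * (\<integral>\<^sup>+t. ennreal (F t * dens t) * indicator {x..} t \<partial>lborel) \<le> ennreal (B * dens x)"
    if x: "R \<le> x" for x
  proof -
    have "ennreal lam * (\<integral>\<^sup>+t. ennreal (F t * dens t) * indicator {x..} t \<partial>lborel)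
        = (\<integral>\<^sup>+t. ennreal lam * (ennreal (F t * dens t) * indicator {x..} t) \<partial>lborel)"
      by (rule nn_integral_cmult[symmetric]) simp
    also have "\<dots> \<le> (\<integral>\<^sup>+t. ennreal (B * ((t ^ 3 - 4 * t) * dens t)) * indicator {x..} t \<partial>lborel)"
      using key x lam(1) F0 dens_pos
      by (intro nn_integral_mono)
        (auto simp: ennreal_mult[symmetric] less_imp_le intro!: ennreal_leI split: split_indicator)
    also have "\<dots> = ennreal (0 - (- B * dens x))"
    proof (rule nn_integral_FTC_atLeast)
      show "((\<lambda>x. - B * dens x) has_real_derivative B * ((y ^ 3 - 4 * y) * dens y)) (at y)" for y
        by (auto intro!: derivative_eq_intros DERIV_dens simp: algebra_simps)
      show "0 \<le> B * ((y ^ 3 - 4 * y) * dens y)" if "x \<le> y" for y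
        using key[of y] F0[of y] that x lam(1) dens_pos[of y]
        by (meson mult_nonneg_nonneg order_trans less_imp_le)
      show "((\<lambda>x. - B * dens x) \<longlongrightarrow> 0) at_top"
        using tendsto_mult_right_zero[OF dens_tendsto_0, of "- B"] by simp
    qed simp
    finally show ?thesis by simp
  qed
  have int: "ennreal A + (\<integral>\<^sup>+t. ennreal B * indicator {R..x} t \<partial>lborel) \<le> ennreal (F x)" if "R \<le> x" for x
    using that A B by (simp add: nn_integral_cmult_indicator F_def flip: ennreal_mult ennreal_plus)
  show ?thesis
    unfolding supersolution_def
    by (rule exI[of _ "\<lambda>_. B"], rule exI[of _ F]) (use tail int F0 B in auto)
qed

text \<open>The inequality says that - P' * \<open>dens\<close> has derivative at least lam * P *
  \<open>dens\<close>. Integrating from x to b leaves the boundary term P' b *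
  \<open>dens b\<close>, which is exactly the bound already known for the integral beyond b. Hence
  matching value and slope at b suffices.\<close>

lemma supersolution_step:
  assumes sup: "supersolution lam b A B" and lam: "0 \<le> lam" and ab: "a < b"
    and P: "\<And>x. (P has_real_derivative P' x) (at x)" "\<And>x. (P' has_real_derivative P'' x) (at x)"
    and P'': "\<And>x. isCont P'' x"
    and nonneg: "\<And>x. a \<le> x \<Longrightarrow> x \<le> b \<Longrightarrow> 0 \<le> P x" and pos: "\<And>x. a \<le> x \<Longrightarrow> x \<le> b \<Longrightarrow> 0 < P' x"
    and ineq: "\<And>x. a \<le> x \<Longrightarrow> x \<le> b \<Longrightarrow> P'' x - (x ^ 3 - 4 * x) * P' x + lam * P x \<le> 0"
    and joint: "P b = A" "P' b = B"
  shows "supersolution lam a (P a) (P' a)"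
proof -
  from sup obtain w F where [measurable]: "w \<in> borel_measurable borel" "F \<in> borel_measurable borel"
    and wb: "w b = B" and w: "\<And>x. b \<le> x \<Longrightarrow> 0 < w x" and F: "\<And>x. b \<le> x \<Longrightarrow> 0 \<le> F x"
    and wF: "\<And>x. b \<le> x \<Longrightarrow> ennreal A + (\<integral>\<^sup>+t. ennreal (w t) * indicator {b..x} t \<partial>lborel) \<le> ennreal (F x)"
    and FE: "\<And>x. b \<le> x \<Longrightarrow> ennreal lam * (\<integral>\<^sup>+t. ennreal (F t * dens t) * indicator {x..} t \<partial>lborel)
             \<le> ennreal (w x * dens x)"
    unfolding supersolution_def by blast
  have mP [measurable]: "P \<in> borel_measurable borel" "P' \<in> borel_measurable borel" "P'' \<in> borel_measurable borel"
    using P[THEN DERIV_isCont] P''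
    by (auto intro!: borel_measurable_continuous_onI continuous_at_imp_continuous_on)
  \<comment> \<open>The joint itself belongs to the old part. Below, b is counted in both closed
    intervals, which is harmless since only upper bounds are required.\<close>
  define w' where "w' x = (if x < b then P' x else w x)" for x
  define F' where "F' x = (if x < b then P x else F x)" for x
  have [measurable]: "w' \<in> borel_measurable borel" "F' \<in> borel_measurable borel"
    unfolding w'_def F'_def by measurable
  have intP': "(\<integral>\<^sup>+t. ennreal (P' t) * indicator {a..x} t \<partial>lborel) = ennreal (P x - P a)" if "a \<le> x" "x \<le> b" for x
    by (rule nn_integral_FTC_Icc) (use that P pos in \<open>auto simp: less_imp_le\<close>)
  have monoP: "P a \<le> P x" if "a \<le> x" "x \<le> b" for x
  proof (rule DERIV_nonneg_imp_nondecreasing[OF that(1)])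
    fix t assume "a \<le> t" "t \<le> x"
    then show "\<exists>y. (P has_real_derivative y) (at t) \<and> 0 \<le> y"
      using P(1)[of t] pos[of t] that by (intro exI[of _ "P' t"]) simp
  qed
  have 1: "ennreal (P a) + (\<integral>\<^sup>+t. ennreal (w' t) * indicator {a..x} t \<partial>lborel) \<le> ennreal (F' x)" if "a \<le> x" for x
  proof (cases "x < b")
    case True
    have "(\<integral>\<^sup>+t. ennreal (w' t) * indicator {a..x} t \<partial>lborel) = (\<integral>\<^sup>+t. ennreal (P' t) * indicator {a..x} t \<partial>lborel)"
      using True by (intro nn_integral_cong) (auto simp: w'_def split: split_indicator)
    also have "\<dots> = ennreal (P x - P a)" using True that by (intro intP') auto
    finally have "ennreal (P a) + (\<integral>\<^sup>+t. ennreal (w' t) * indicator {a..x} t \<partial>lborel) = ennreal (P a + (P x - P a))"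
      using nonneg[of a] ab that True monoP[of x] by (subst ennreal_plus) auto
    then show ?thesis using True by (simp add: F'_def)
  next
    case False
    have "(\<integral>\<^sup>+t. ennreal (w' t) * indicator {a..x} t \<partial>lborel)
      \<le> (\<integral>\<^sup>+t. ennreal (P' t) * indicator {a..b} t + ennreal (w t) * indicator {b..x} t \<partial>lborel)"
      by (intro nn_integral_mono) (auto simp: w'_def split: split_indicator)
    also have "\<dots> = ennreal (P b - P a) + (\<integral>\<^sup>+t. ennreal (w t) * indicator {b..x} t \<partial>lborel)"
      using ab by (subst nn_integral_add) (auto simp: intP')
    finally have "ennreal (P a) + (\<integral>\<^sup>+t. ennreal (w' t) * indicator {a..x} t \<partial>lborel) \<le>
        ennreal (P a) + ennreal (P b - P a) + (\<integral>\<^sup>+t. ennreal (w t) * indicator {b..x} t \<partial>lborel)"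
      by (simp add: add.assoc add_left_mono)
    also have "ennreal (P a) + ennreal (P b - P a) = ennreal (P a + (P b - P a))"
      using nonneg[of a] ab monoP[of b] by (intro ennreal_plus[symmetric]) auto
    finally show ?thesis using wF[of x] False by (simp add: F'_def joint)
  qed
  have 2: "ennreal lam * (\<integral>\<^sup>+t. ennreal (F' t * dens t) * indicator {x..} t \<partial>lborel) \<le> ennreal (w' x * dens x)"
    if "a \<le> x" for x
  proof (cases "x < b")
    case False
    then have "(\<integral>\<^sup>+t. ennreal (F' t * dens t) * indicator {x..} t \<partial>lborel) = (\<integral>\<^sup>+t. ennreal (F t * dens t) * indicator {x..} t \<partial>lborel)"
      by (intro nn_integral_cong) (auto simp: F'_def split: split_indicator)
    then show ?thesis using FE[of x] False by (simp add: w'_def)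
  next
    case True
    define D where "D t = - (P'' t - (t ^ 3 - 4 * t) * P' t) * dens t" for t
    have D: "lam * (P t * dens t) \<le> D t" if "a \<le> t" "t \<le> b" for t
    proof -
      have "lam * P t * dens t \<le> - (P'' t - (t ^ 3 - 4 * t) * P' t) * dens t"
        using ineq[OF that] dens_pos[of t] by (intro mult_right_mono) auto
      then show ?thesis by (simp add: D_def mult_ac)
    qed
    have D0: "0 \<le> D t" if "a \<le> t" "t \<le> b" for t
      using D[OF that] nonneg[OF that] lam dens_pos[of t] by (meson mult_nonneg_nonneg order_trans less_imp_le)
    have dD: "((\<lambda>t. - (P' t * dens t)) has_real_derivative D t) (at t)" for t
      unfolding D_def by (auto intro!: derivative_eq_intros P DERIV_dens simp: algebra_simps)
    have [measurable]: "D \<in> borel_measurable borel" unfolding D_def by measurable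
    have intD: "(\<integral>\<^sup>+t. ennreal (D t) * indicator {x..b} t \<partial>lborel) = ennreal (- (P' b * dens b) - (- (P' x * dens x)))"
      by (rule nn_integral_FTC_Icc) (use that True dD D0 in auto)
    have mono: "0 \<le> - (P' b * dens b) - (- (P' x * dens x))"
    proof -
      have "- (P' x * dens x) \<le> - (P' b * dens b)"
      proof (rule DERIV_nonneg_imp_nondecreasing[of x b "\<lambda>t. - (P' t * dens t)"])
        fix t assume "x \<le> t" "t \<le> b"
        then show "\<exists>y. ((\<lambda>t. - (P' t * dens t)) has_real_derivative y) (at t) \<and> 0 \<le> y"
          using dD[of t] D0[of t] that by (intro exI[of _ "D t"]) simp
      qed (use True in simp)
      then show ?thesis by simp
    qed
    have "ennreal lam * (\<integral>\<^sup>+t. ennreal (F' t * dens t) * indicator {x..} t \<partial>lborel)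
      = (\<integral>\<^sup>+t. ennreal lam * (ennreal (F' t * dens t) * indicator {x..} t) \<partial>lborel)"
      by (rule nn_integral_cmult[symmetric]) simp
    also have "\<dots> \<le> (\<integral>\<^sup>+t. ennreal (D t) * indicator {x..b} t + ennreal lam * (ennreal (F t * dens t) * indicator {b..} t) \<partial>lborel)"
    proof (rule nn_integral_mono)
      fix t
      show "ennreal lam * (ennreal (F' t * dens t) * indicator {x..} t) \<le> ennreal (D t) * indicator {x..b} t + ennreal lam * (ennreal (F t * dens t) * indicator {b..} t)"
      proof (cases "x \<le> t \<and> t < b")
        case True
        then have "ennreal lam * ennreal (P t * dens t) \<le> ennreal (D t)"
          using D[of t] that lam nonneg[of t] dens_pos[of t]
          by (subst ennreal_mult[symmetric]) (auto simp: less_imp_le intro!: ennreal_leI)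
        then show ?thesis using True by (simp add: F'_def)
      next
        case False
        then show ?thesis by (auto simp: F'_def split: split_indicator)
      qed
    qed
    also have "\<dots> = ennreal (- (P' b * dens b) - (- (P' x * dens x))) + ennreal lam * (\<integral>\<^sup>+t. ennreal (F t * dens t) * indicator {b..} t \<partial>lborel)"
      by (subst nn_integral_add) (auto simp: nn_integral_cmult intD)
    also have "\<dots> \<le> ennreal (- (P' b * dens b) - (- (P' x * dens x))) + ennreal (w b * dens b)"
      by (intro add_left_mono FE) simp
    also have "\<dots> = ennreal (P' x * dens x)"
      using mono w[of b] dens_pos[of b] by (subst ennreal_plus[symmetric]) (auto simp: wb joint less_imp_le)
    finally show ?thesis using True by (simp add: w'_def)
  qed
  show ?thesis
    unfolding supersolution_def
    by (rule exI[of _ w'], rule exI[of _ F'])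
      (use 1 2 ab w F pos nonneg in \<open>auto simp: w'_def F'_def\<close>)
qed

section \<open>Subsolutions\<close>

lemma integrable_bounded_dens:
  assumes [measurable]: "h \<in> borel_measurable borel" and "\<And>x. \<bar>h x\<bar> \<le> K"
  shows "integrable lborel (\<lambda>x. h x * dens x)"
proof (rule Bochner_Integration.integrable_bound)
  show "integrable lborel (\<lambda>x. K * dens x)" using integrable_dens by simp
  have "0 \<le> K" using assms(2)[of 0] by linarith
  then show "AE x in lborel. norm (h x * dens x) \<le> norm (K * dens x)"
    using assms(2) dens_pos by (intro AE_I2) (auto simp: abs_mult less_imp_le intro!: mult_right_mono)
qed simp

section \<open>Primitives and integrals over adjacent intervals\<close>

definition primitive :: "(real \<Rightarrow> real) \<Rightarrow> real \<Rightarrow> real \<Rightarrow> real" where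
  "primitive g a x = (LINT t:{a..x}|lborel. g t)"

lemma set_integrable_subinterval:
  fixes g :: "real \<Rightarrow> real"
  assumes "\<And>a b. set_integrable lborel {a..b} g" "S \<in> sets borel" "S \<subseteq> {a..b}"
  shows "set_integrable lborel S g"
  using set_integrable_subset[OF assms(1)] assms(2,3) by auto

lemma set_integral_split_point:
  fixes g :: "real \<Rightarrow> real"
  assumes "set_integrable lborel (S \<union> T) g" "S \<in> sets borel" "T \<in> sets borel" "S \<inter> T \<subseteq> {b}"
  shows "(LINT t:S \<union> T|lborel. g t) = (LINT t:S|lborel. g t) + (LINT t:T|lborel. g t)"
proof (rule set_integral_Un_AE)
  show "AE x in lborel. \<not> (x \<in> S \<and> x \<in> T)"
    using AE_lborel_singleton[of b] by eventually_elim (use assms(4) in blast)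
qed (use assms set_integrable_subset[OF assms(1)] in auto)

lemma primitive_split:
  assumes "\<And>a b. set_integrable lborel {a..b} g" "a \<le> b" "b \<le> x"
  shows "primitive g a x = primitive g a b + primitive g b x"
proof -
  have "{a..x} = {a..b} \<union> {b..x}" using assms(2,3) by auto
  then show ?thesis
    unfolding primitive_def
    using set_integral_split_point[of "{a..b}" "{b..x}" g b] assms(1)[of a x] assms(2,3)
    by (auto simp: max_def min_def simp del: atLeastAtMost_iff)
qed

lemma set_integral_cong_except:
  fixes g h :: "real \<Rightarrow> real"
  assumes [measurable]: "g \<in> borel_measurable borel" "h \<in> borel_measurable borel" "S \<in> sets borel"
    and "\<And>t. t \<in> S \<Longrightarrow> t \<noteq> b \<Longrightarrow> g t = h t"
  shows "(LINT t:S|lborel. g t) = (LINT t:S|lborel. h t)"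
proof (rule set_lebesgue_integral_cong_AE)
  show "AE x\<in>S in lborel. g x = h x"
    using AE_lborel_singleton[of b] by eventually_elim (use assms(4) in blast)
qed auto

lemma borel_measurable_primitive [measurable]:
  assumes [measurable]: "g \<in> borel_measurable borel"
  shows "primitive g a \<in> borel_measurable borel"
proof -
  have "primitive g a = (\<lambda>x. LINT t|lborel. (if a \<le> t \<and> t \<le> x then g t else 0))"
    unfolding primitive_def set_lebesgue_integral_def
    by (intro ext Bochner_Integration.integral_cong) auto
  then show ?thesis by simp
qed

lemma set_integrable_bounded:
  fixes g :: "real \<Rightarrow> real"
  assumes [measurable]: "g \<in> borel_measurable borel" and "\<And>x. \<bar>g x\<bar> \<le> L"
  shows "set_integrable lborel {a..b} g"
  unfolding set_integrable_def
proof (rule Bochner_Integration.integrable_bound)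
  show "integrable lborel (\<lambda>x. indicator {a..b} x *\<^sub>R L)"
    using borel_integrable_atLeastAtMost'[of a b "\<lambda>_. L"] by (simp add: set_integrable_def)
  show "AE x in lborel. norm (indicat_real {a..b} x *\<^sub>R g x) \<le> norm (indicat_real {a..b} x *\<^sub>R L)"
    using assms(2) by (intro AE_I2) (auto split: split_indicator intro: order_trans[OF _ abs_ge_self])
qed simp

lemma primitive_bounded:
  assumes [measurable]: "g \<in> borel_measurable borel" and L: "\<And>x. \<bar>g x\<bar> \<le> L"
    and M: "\<And>x. M \<le> x \<Longrightarrow> g x = 0" "a \<le> M"
  shows "\<bar>primitive g a x\<bar> \<le> L * (M - a)"
proof -
  have "norm (LINT t:{a..x}|lborel. g t) \<le> (LINT t|lborel. indicator {a..M} t *\<^sub>R L)"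
    unfolding set_lebesgue_integral_def
  proof (rule Bochner_Integration.integral_norm_bound_integral)
    show "integrable lborel (\<lambda>t. indicat_real {a..x} t *\<^sub>R g t)"
      using set_integrable_bounded[of g L a x] L by (simp add: set_integrable_def)
    show "integrable lborel (\<lambda>t. indicat_real {a..M} t *\<^sub>R L)"
      using borel_integrable_atLeastAtMost'[of a M "\<lambda>_. L"] by (simp add: set_integrable_def)
    have "0 \<le> L" using L[of 0] by linarith
    then show "norm (indicat_real {a..x} t *\<^sub>R g t) \<le> indicat_real {a..M} t *\<^sub>R L" for t
      using L[of t] M(1)[of t] by (cases "t \<le> M") (auto split: split_indicator)
  qed
  also have "\<dots> = L * (M - a)" using M(2) by simp
  finally show ?thesis by (simp add: primitive_def)
qed

text \<open>
  The test function is \<open>y + primitive g a\<close>. The boundary term \<open>y * B * dens a\<close> is what integration by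
  parts leaves at \<open>a\<close>, so that the pieces of a certificate can be attached from right to left;
  the starting value \<open>y\<close> is quantified because it is only known once the pieces to the left are chosen.
  The constant \<open>k\<close> keeps the test function from vanishing identically.
\<close>

definition subsolution :: "real \<Rightarrow> real \<Rightarrow> real \<Rightarrow> real \<Rightarrow> real \<Rightarrow> bool" where
  "subsolution lam k a A B \<longleftrightarrow>
     (\<exists>g M L. g \<in> borel_measurable borel \<and> a \<le> M \<and> (\<forall>x. \<bar>g x\<bar> \<le> L) \<and> (\<forall>x\<ge>M. g x = 0) \<and>
        (\<forall>y\<ge>A. (\<forall>x\<ge>a. 0 \<le> y + primitive g a x) \<and> (\<forall>x\<ge>M. k \<le> y + primitive g a x) \<and>
           (LINT x:{a..}|lborel. (g x)\<^sup>2 * dens x) + y * (B * dens a)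
             \<le> lam * (LINT x:{a..}|lborel. (y + primitive g a x)\<^sup>2 * dens x)))"

text \<open>Continuing by a constant costs no energy, and a slope B \<le> 0 makes the boundary term
  nonpositive: raising a negative slope to 0 is a convex kink, the direction a subsolution
  tolerates. The constant is at least A, which serves as \<open>k\<close>.\<close>

lemma subsolution_tail:
  assumes "0 \<le> lam" "0 \<le> A" "B \<le> 0"
  shows "subsolution lam A R A B"
  unfolding subsolution_def
proof (intro exI conjI allI impI)
  fix y assume y: "A \<le> y"
  show "0 \<le> y + primitive (\<lambda>_. 0) R x" "A \<le> y + primitive (\<lambda>_. 0) R x" for x
    using y assms by (auto simp: primitive_def)
  have "y * (B * dens R) \<le> 0"
    using y assms dens_pos[of R] by (intro mult_nonneg_nonpos mult_nonpos_nonneg) auto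
  also have "0 \<le> lam * (LINT x:{R..}|lborel. (y + primitive (\<lambda>_. 0) R x)\<^sup>2 * dens x)"
    unfolding set_lebesgue_integral_def
    by (intro mult_nonneg_nonneg assms Bochner_Integration.integral_nonneg) (simp add: dens_pos less_imp_le)
  finally show "(LINT x:{R..}|lborel. (0::real)\<^sup>2 * dens x) + y * (B * dens R)
      \<le> lam * (LINT x:{R..}|lborel. (y + primitive (\<lambda>_. 0) R x)\<^sup>2 * dens x)"
    by simp
qed auto

text \<open>Integrating the derivative of Q * P' * \<open>dens\<close>, where Q is P shifted to
  start at y, bounds the energy on [a, b] by lam times the mass plus boundary terms. The term at b
  is the one carried by the old certificate, taken with starting value Q b, and cancels.\<close>

lemma subsolution_step:
  assumes sub: "subsolution lam k b A B" and lam: "0 \<le> lam" and ab: "a < b"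
    and P: "\<And>x. (P has_real_derivative P' x) (at x)" "\<And>x. (P' has_real_derivative P'' x) (at x)"
    and P'': "\<And>x. isCont P'' x"
    and nonneg: "\<And>x. a \<le> x \<Longrightarrow> x \<le> b \<Longrightarrow> 0 \<le> P x"
    and ineq: "\<And>x. a \<le> x \<Longrightarrow> x \<le> b \<Longrightarrow> 0 \<le> P'' x - (x ^ 3 - 4 * x) * P' x + lam * P x"
    and joint: "P b = A" "P' b = B"
  shows "subsolution lam k a (P a) (P' a)"
proof -
  from sub obtain g M L where [measurable]: "g \<in> borel_measurable borel" and bM: "b \<le> M"
    and L: "\<And>x. \<bar>g x\<bar> \<le> L" and M: "\<And>x. M \<le> x \<Longrightarrow> g x = 0"
    and gy: "\<And>y. A \<le> y \<Longrightarrow> (\<forall>x\<ge>b. 0 \<le> y + primitive g b x)"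
      "\<And>y. A \<le> y \<Longrightarrow> (\<forall>x\<ge>M. k \<le> y + primitive g b x)"
      "\<And>y. A \<le> y \<Longrightarrow> (LINT x:{b..}|lborel. (g x)\<^sup>2 * dens x) + y * (B * dens b)
             \<le> lam * (LINT x:{b..}|lborel. (y + primitive g b x)\<^sup>2 * dens x)"
    unfolding subsolution_def by blast
  have contP: "isCont P x" "isCont P' x" for x
    using P by (auto intro: DERIV_isCont)
  have mP [measurable]: "P \<in> borel_measurable borel" "P' \<in> borel_measurable borel" "P'' \<in> borel_measurable borel"
    using contP P''
    by (auto intro!: borel_measurable_continuous_onI continuous_at_imp_continuous_on)
  \<comment> \<open>The value 0 to the left of a makes the uniform bound on the derivative hold on
    the whole line.\<close>
  define h where "h x = (if x < b then (if a \<le> x then P' x else 0) else g x)" for x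
  have mh [measurable]: "h \<in> borel_measurable borel"
    unfolding h_def by measurable
  have "compact (P' ` {a..b})"
    using contP by (intro compact_continuous_image continuous_at_imp_continuous_on) auto
  then obtain K where K: "\<And>x. a \<le> x \<Longrightarrow> x \<le> b \<Longrightarrow> \<bar>P' x\<bar> \<le> K"
    using compact_imp_bounded[of "P' ` {a..b}"] unfolding bounded_iff by (metis atLeastAtMost_iff image_eqI real_norm_def)
  have hL: "\<bar>h x\<bar> \<le> max K L" for x
    using L[of x] K[of x] L[of 0] by (auto simp: h_def le_max_iff_disj)
  have hM: "h x = 0" if "M \<le> x" for x
    using M[OF that] bM that by (simp add: h_def)
  have hI: "set_integrable lborel {s..t} h" for s t
    by (rule set_integrable_bounded[OF mh hL])
  have prim1: "primitive h a x = P x - P a" if "a \<le> x" "x \<le> b" for x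
  proof -
    have "primitive h a x = (LINT t:{a..x}|lborel. P' t)"
      unfolding primitive_def
      by (rule set_integral_cong_except[where b = b]) (use that in \<open>auto simp: h_def\<close>)
    also have "\<dots> = P x - P a"
      using integral_FTC_Icc_real[of a x P P'] that P contP
      by (simp add: set_lebesgue_integral_def mult.commute)
    finally show ?thesis .
  qed
  have prim2: "primitive h a x = P b - P a + primitive g b x" if "b \<le> x" for x
  proof -
    have "primitive h a x = primitive h a b + primitive h b x"
      using ab that by (intro primitive_split hI) auto
    also have "primitive h b x = primitive g b x"
      unfolding primitive_def by (rule set_integral_cong_except[where b = b]) (auto simp: h_def)
    finally show ?thesis using ab by (simp add: prim1)
  qed
  have intF: "integrable lborel (\<lambda>x. (y + primitive h a x)\<^sup>2 * dens x)" for y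
  proof (rule integrable_bounded_dens)
    show "\<bar>(y + primitive h a x)\<^sup>2\<bar> \<le> (\<bar>y\<bar> + max K L * (M - a))\<^sup>2" for x
    proof -
      have "\<bar>primitive h a x\<bar> \<le> max K L * (M - a)"
        using ab bM by (intro primitive_bounded mh hL hM) auto
      then have "\<bar>y + primitive h a x\<bar> \<le> \<bar>y\<bar> + max K L * (M - a)" by linarith
      then have "\<bar>y + primitive h a x\<bar>\<^sup>2 \<le> (\<bar>y\<bar> + max K L * (M - a))\<^sup>2"
        by (intro power_mono) auto
      then show ?thesis by simp
    qed
  qed measurable
  have intH: "integrable lborel (\<lambda>x. (h x)\<^sup>2 * dens x)"
  proof (rule integrable_bounded_dens)
    show "\<bar>(h x)\<^sup>2\<bar> \<le> (max K L)\<^sup>2" for x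
      using power_mono[OF hL[of x], of 2] by simp
  qed measurable
  have main: "(LINT x:{a..}|lborel. (h x)\<^sup>2 * dens x) + y * (P' a * dens a)
        \<le> lam * (LINT x:{a..}|lborel. (y + primitive h a x)\<^sup>2 * dens x)" if y: "P a \<le> y" for y
  proof -
    \<comment> \<open>Since y \<ge> P a, the shift is upwards and only increases lam * P, so the
      differential inequality for P passes to Q.\<close>
    define Q where "Q x = y - P a + P x" for x
    have Q: "(Q has_real_derivative P' x) (at x)" for x
      unfolding Q_def by (auto intro!: derivative_eq_intros P)
    have contQ: "isCont Q x" for x using Q by (rule DERIV_isCont)
    define D where "D x = (P' x)\<^sup>2 * dens x + Q x * ((P'' x - (x ^ 3 - 4 * x) * P' x) * dens x)" for x
    have dD: "((\<lambda>x. Q x * (P' x * dens x)) has_real_derivative D x) (at x)" for x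
      unfolding D_def
      by (auto intro!: derivative_eq_intros P Q DERIV_dens simp: algebra_simps power2_eq_square)
    have contD: "isCont D x" for x
      unfolding D_def by (intro continuous_intros contP P'' contQ isCont_dens)
    have FTC: "has_bochner_integral lborel (\<lambda>x. D x * indicator {a..b} x) (Q b * (P' b * dens b) - Q a * (P' a * dens a))"
      using ab by (intro has_bochner_integral_FTC_Icc_real dD contD) auto
    have I1: "set_integrable lborel {a..b} (\<lambda>x. (P' x)\<^sup>2 * dens x)"
      by (intro borel_integrable_atLeastAtMost' continuous_at_imp_continuous_on ballI continuous_intros contP isCont_dens)
    have I2: "set_integrable lborel {a..b} (\<lambda>x. (Q x)\<^sup>2 * dens x)"
      by (intro borel_integrable_atLeastAtMost' continuous_at_imp_continuous_on ballI continuous_intros contQ isCont_dens)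
    have "(LINT x:{a..b}|lborel. (P' x)\<^sup>2 * dens x - lam * ((Q x)\<^sup>2 * dens x)) \<le> (LINT x:{a..b}|lborel. D x)"
    proof (rule set_integral_mono)
      show "set_integrable lborel {a..b} (\<lambda>x. (P' x)\<^sup>2 * dens x - lam * ((Q x)\<^sup>2 * dens x))"
        by (intro set_integral_diff set_integrable_mult_right I1 I2)
      show "set_integrable lborel {a..b} D"
        using contD by (intro borel_integrable_atLeastAtMost' continuous_at_imp_continuous_on) auto
      fix x assume "x \<in> {a..b}"
      then have x: "a \<le> x" "x \<le> b" by auto
      have PQ: "0 \<le> P x" "P x \<le> Q x" using nonneg[OF x] y by (auto simp: Q_def)
      then have "lam * P x \<le> lam * Q x" using lam by (intro mult_left_mono)
      then have "- (lam * Q x) \<le> P'' x - (x ^ 3 - 4 * x) * P' x" using ineq[OF x] by linarith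
      then have "Q x * (- (lam * Q x) * dens x) \<le> Q x * ((P'' x - (x ^ 3 - 4 * x) * P' x) * dens x)"
        using PQ dens_pos[of x] by (intro mult_left_mono mult_right_mono) auto
      then show "(P' x)\<^sup>2 * dens x - lam * ((Q x)\<^sup>2 * dens x) \<le> D x"
        by (simp add: D_def power2_eq_square algebra_simps)
    qed
    also have "(LINT x:{a..b}|lborel. D x) = Q b * (B * dens b) - y * (P' a * dens a)"
      using has_bochner_integral_integral_eq[OF FTC]
      by (simp add: set_lebesgue_integral_def mult.commute[of "indicator _ _"] Q_def joint)
    also have "(LINT x:{a..b}|lborel. (P' x)\<^sup>2 * dens x - lam * ((Q x)\<^sup>2 * dens x))
       = (LINT x:{a..b}|lborel. (P' x)\<^sup>2 * dens x) - lam * (LINT x:{a..b}|lborel. (Q x)\<^sup>2 * dens x)"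
      using I1 I2 by (simp add: set_integral_diff)
    finally have piece: "(LINT x:{a..b}|lborel. (P' x)\<^sup>2 * dens x) + y * (P' a * dens a)
      \<le> lam * (LINT x:{a..b}|lborel. (Q x)\<^sup>2 * dens x) + Q b * (B * dens b)" by linarith
    have rest: "(LINT x:{b..}|lborel. (g x)\<^sup>2 * dens x) + Q b * (B * dens b)
             \<le> lam * (LINT x:{b..}|lborel. (Q b + primitive g b x)\<^sup>2 * dens x)"
      using y by (intro gy) (simp add: Q_def joint)
    have un: "{a..} = {a..b} \<union> {b..}" using ab by auto
    have "(LINT x:{a..}|lborel. (h x)\<^sup>2 * dens x) = (LINT x:{a..b}|lborel. (h x)\<^sup>2 * dens x) + (LINT x:{b..}|lborel. (h x)\<^sup>2 * dens x)"
      unfolding un by (rule set_integral_split_point[where b = b])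
        (use integrable_mult_indicator[OF _ intH] in \<open>auto simp: set_integrable_def\<close>)
    also have "(LINT x:{a..b}|lborel. (h x)\<^sup>2 * dens x) = (LINT x:{a..b}|lborel. (P' x)\<^sup>2 * dens x)"
      by (rule set_integral_cong_except[where b = b]) (auto simp: h_def)
    also have "(LINT x:{b..}|lborel. (h x)\<^sup>2 * dens x) = (LINT x:{b..}|lborel. (g x)\<^sup>2 * dens x)"
      by (rule set_integral_cong_except[where b = b]) (auto simp: h_def)
    finally have e1: "(LINT x:{a..}|lborel. (h x)\<^sup>2 * dens x) = (LINT x:{a..b}|lborel. (P' x)\<^sup>2 * dens x) + (LINT x:{b..}|lborel. (g x)\<^sup>2 * dens x)" .
    have "(LINT x:{a..}|lborel. (y + primitive h a x)\<^sup>2 * dens x) = (LINT x:{a..b}|lborel. (y + primitive h a x)\<^sup>2 * dens x) + (LINT x:{b..}|lborel. (y + primitive h a x)\<^sup>2 * dens x)"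
      unfolding un by (rule set_integral_split_point[where b = b])
        (use integrable_mult_indicator[OF _ intF] in \<open>auto simp: set_integrable_def\<close>)
    also have "(LINT x:{a..b}|lborel. (y + primitive h a x)\<^sup>2 * dens x) = (LINT x:{a..b}|lborel. (Q x)\<^sup>2 * dens x)"
      by (rule set_lebesgue_integral_cong) (auto simp: prim1 Q_def algebra_simps)
    also have "(LINT x:{b..}|lborel. (y + primitive h a x)\<^sup>2 * dens x) = (LINT x:{b..}|lborel. (Q b + primitive g b x)\<^sup>2 * dens x)"
      by (rule set_lebesgue_integral_cong) (auto simp: prim2 Q_def algebra_simps)
    finally show ?thesis
      using piece rest unfolding e1 by (simp add: distrib_left)
  qed
  show ?thesis
    unfolding subsolution_def
  proof (intro exI conjI allI impI)
    fix y assume y: "P a \<le> y"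
    show "0 \<le> y + primitive h a x" if "a \<le> x" for x
    proof (cases "x \<le> b")
      case True
      then show ?thesis using nonneg[OF that True] y that by (simp add: prim1)
    next
      case False
      then show ?thesis using gy(1)[of "y - P a + P b"] y joint by (auto simp: prim2 algebra_simps)
    qed
    show "k \<le> y + primitive h a x" if "M \<le> x" for x
      using gy(2)[of "y - P a + P b"] y joint that bM by (auto simp: prim2 algebra_simps)
  qed (use bM ab hL hM main in auto)
qed

section \<open>A weighted Hardy inequality\<close>

text \<open>
  Cauchy--Schwarz with weight \<open>w\<close>, then Tonelli.
\<close>

lemma hardy_halfline:
  assumes sup: "supersolution lam 0 A B" and lam: "0 < lam"
    and [measurable]: "g \<in> borel_measurable borel"
  shows "(\<integral>\<^sup>+x. ((\<integral>\<^sup>+t. ennreal \<bar>g t\<bar> * indicator {0..x} t \<partial>lborel)\<^sup>2 * ennreal (dens x)) * indicator {0..} x \<partial>lborel)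
    \<le> ennreal (1 / lam) * (\<integral>\<^sup>+t. ennreal ((g t)\<^sup>2 * dens t) * indicator {0..} t \<partial>lborel)"
proof -
  from sup obtain w F where [measurable]: "w \<in> borel_measurable borel" "F \<in> borel_measurable borel"
    and w: "\<And>x. 0 \<le> x \<Longrightarrow> 0 < w x" and F: "\<And>x. 0 \<le> x \<Longrightarrow> 0 \<le> F x"
    and wF: "\<And>x. 0 \<le> x \<Longrightarrow> ennreal A + (\<integral>\<^sup>+t. ennreal (w t) * indicator {0..x} t \<partial>lborel) \<le> ennreal (F x)"
    and FE: "\<And>x. 0 \<le> x \<Longrightarrow> ennreal lam * (\<integral>\<^sup>+t. ennreal (F t * dens t) * indicator {x..} t \<partial>lborel)
             \<le> ennreal (w x * dens x)"
    unfolding supersolution_def by blast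
  define K where "K x t = (if 0 \<le> t \<and> t \<le> x then ennreal ((g t)\<^sup>2 / w t) * ennreal (F x * dens x) else 0)" for x t
  have K[measurable]: "case_prod K \<in> borel_measurable (lborel \<Otimes>\<^sub>M lborel)"
    unfolding K_def case_prod_beta by measurable
  \<comment> \<open>Write \<bar>g\<bar> as (\<bar>g\<bar> / sqrt w) * sqrt w. The squared second
    factor integrates over [0, x] to at most F x, by the growth clause of the supersolution with
    \<open>ennreal A\<close> dropped.\<close>
  have CS: "(\<integral>\<^sup>+t. ennreal \<bar>g t\<bar> * indicator {0..x} t \<partial>lborel)\<^sup>2 * ennreal (dens x) \<le> (\<integral>\<^sup>+t. K x t \<partial>lborel)"
    if x: "0 \<le> x" for x
  proof -
    have "(\<integral>\<^sup>+t. ennreal \<bar>g t\<bar> * indicator {0..x} t \<partial>lborel)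
      = (\<integral>\<^sup>+t. (ennreal (\<bar>g t\<bar> / sqrt (w t)) * indicator {0..x} t) * (ennreal (sqrt (w t)) * indicator {0..x} t) \<partial>lborel)"
      using w by (intro nn_integral_cong) (auto simp: less_imp_le less_imp_neq[THEN not_sym] simp flip: ennreal_mult split: split_indicator)
    then have "(\<integral>\<^sup>+t. ennreal \<bar>g t\<bar> * indicator {0..x} t \<partial>lborel)\<^sup>2
      \<le> (\<integral>\<^sup>+t. (ennreal (\<bar>g t\<bar> / sqrt (w t)) * indicator {0..x} t)\<^sup>2 \<partial>lborel)
        * (\<integral>\<^sup>+t. (ennreal (sqrt (w t)) * indicator {0..x} t)\<^sup>2 \<partial>lborel)"
      by (simp only:) (rule Cauchy_Schwarz_nn_integral; simp)
    also have "(\<integral>\<^sup>+t. (ennreal (\<bar>g t\<bar> / sqrt (w t)) * indicator {0..x} t)\<^sup>2 \<partial>lborel)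
      = (\<integral>\<^sup>+t. ennreal ((g t)\<^sup>2 / w t) * indicator {0..x} t \<partial>lborel)"
      using w by (intro nn_integral_cong) (auto simp: less_imp_le power_divide ennreal_power split: split_indicator)
    also have "(\<integral>\<^sup>+t. (ennreal (sqrt (w t)) * indicator {0..x} t)\<^sup>2 \<partial>lborel)
      = (\<integral>\<^sup>+t. ennreal (w t) * indicator {0..x} t \<partial>lborel)"
      using w by (intro nn_integral_cong) (auto simp: less_imp_le ennreal_power split: split_indicator)
    also have "\<dots> \<le> ennreal (F x)"
      using wF[OF x] by (metis add.commute add_increasing2 order_trans zero_le order_refl)
    finally have "(\<integral>\<^sup>+t. ennreal \<bar>g t\<bar> * indicator {0..x} t \<partial>lborel)\<^sup>2
      \<le> (\<integral>\<^sup>+t. ennreal ((g t)\<^sup>2 / w t) * indicator {0..x} t \<partial>lborel) * ennreal (F x)"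
      by (simp add: mult_left_mono)
    then have "(\<integral>\<^sup>+t. ennreal \<bar>g t\<bar> * indicator {0..x} t \<partial>lborel)\<^sup>2 * ennreal (dens x)
      \<le> (\<integral>\<^sup>+t. ennreal ((g t)\<^sup>2 / w t) * indicator {0..x} t \<partial>lborel) * ennreal (F x) * ennreal (dens x)"
      by (intro mult_right_mono) auto
    also have "\<dots> = (\<integral>\<^sup>+t. ennreal ((g t)\<^sup>2 / w t) * indicator {0..x} t \<partial>lborel) * ennreal (F x * dens x)"
      using F[OF x] dens_pos[of x] by (simp add: ennreal_mult less_imp_le mult.assoc)
    also have "\<dots> = (\<integral>\<^sup>+t. ennreal ((g t)\<^sup>2 / w t) * indicator {0..x} t * ennreal (F x * dens x) \<partial>lborel)"
      by (rule nn_integral_multc[symmetric]) simp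
    also have "\<dots> = (\<integral>\<^sup>+t. K x t \<partial>lborel)"
      by (intro nn_integral_cong) (auto simp: K_def split: split_indicator)
    finally show ?thesis .
  qed
  have "(\<integral>\<^sup>+x. ((\<integral>\<^sup>+t. ennreal \<bar>g t\<bar> * indicator {0..x} t \<partial>lborel)\<^sup>2 * ennreal (dens x)) * indicator {0..} x \<partial>lborel)
    \<le> (\<integral>\<^sup>+x. \<integral>\<^sup>+t. K x t \<partial>lborel \<partial>lborel)"
    using CS by (intro nn_integral_mono) (auto split: split_indicator)
  also have "\<dots> = (\<integral>\<^sup>+t. \<integral>\<^sup>+x. K x t \<partial>lborel \<partial>lborel)"
    by (rule lborel_pair.Fubini'[symmetric]) (rule K)
  also have "\<dots> \<le> (\<integral>\<^sup>+t. ennreal (1 / lam) * (ennreal ((g t)\<^sup>2 * dens t) * indicator {0..} t) \<partial>lborel)"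
  proof (rule nn_integral_mono)
    fix t
    show "(\<integral>\<^sup>+x. K x t \<partial>lborel) \<le> ennreal (1 / lam) * (ennreal ((g t)\<^sup>2 * dens t) * indicator {0..} t)"
    proof (cases "0 \<le> t")
      case True
      \<comment> \<open>For fixed t the variable x runs over [t, \<infinity>), so the last clause of
        the supersolution bounds this integral by w t * \<open>dens t\<close> / lam. The factor w t
        then cancels the 1 / w t left by Cauchy-Schwarz.\<close>
      define I where "I = (\<integral>\<^sup>+x. ennreal (F x * dens x) * indicator {t..} x \<partial>lborel)"
      have "ennreal (1 / lam) * (ennreal lam * I) \<le> ennreal (1 / lam) * ennreal (w t * dens t)"
        unfolding I_def by (intro mult_left_mono FE True) simp
      moreover have "ennreal (1 / lam) * (ennreal lam * I) = I"
        using lam by (simp add: mult.assoc[symmetric] ennreal_mult[symmetric])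
      ultimately have I: "I \<le> ennreal (1 / lam) * ennreal (w t * dens t)" by simp
      have "(\<integral>\<^sup>+x. K x t \<partial>lborel) = (\<integral>\<^sup>+x. ennreal ((g t)\<^sup>2 / w t) * (ennreal (F x * dens x) * indicator {t..} x) \<partial>lborel)"
        using True by (intro nn_integral_cong) (auto simp: K_def split: split_indicator)
      also have "\<dots> = ennreal ((g t)\<^sup>2 / w t) * I"
        unfolding I_def by (rule nn_integral_cmult) simp
      also have "\<dots> \<le> ennreal ((g t)\<^sup>2 / w t) * (ennreal (1 / lam) * ennreal (w t * dens t))"
        by (intro mult_left_mono I) simp
      also have "\<dots> = ennreal (1 / lam) * (ennreal ((g t)\<^sup>2 * dens t) * indicator {0..} t)"
        using w[OF True] lam dens_pos[of t] True by (simp add: ennreal_mult[symmetric] less_imp_le)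
      finally show ?thesis .
    qed (simp add: K_def)
  qed
  also have "\<dots> = ennreal (1 / lam) * (\<integral>\<^sup>+t. ennreal ((g t)\<^sup>2 * dens t) * indicator {0..} t \<partial>lborel)"
    by (rule nn_integral_cmult) simp
  finally show ?thesis .
qed

section \<open>Smooth test functions\<close>

text \<open>Smoothness asks for all iterated derivatives at once, so it is proved through a class
  closed under differentiation. All powers k occur among the flat generators because differentiating
  one of them raises the exponent.\<close>

inductive smooth_class :: "(real \<Rightarrow> real) \<Rightarrow> bool" where
  flat: "smooth_class (\<lambda>x. if 0 < x then exp (- (1 / x)) / x ^ k else 0)"
| const: "smooth_class (\<lambda>_. c)"
| add: "smooth_class f \<Longrightarrow> smooth_class g \<Longrightarrow> smooth_class (\<lambda>x. f x + g x)"
| mult: "smooth_class f \<Longrightarrow> smooth_class g \<Longrightarrow> smooth_class (\<lambda>x. f x * g x)"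
| exp: "smooth_class f \<Longrightarrow> smooth_class (\<lambda>x. exp (f x))"
| affine: "smooth_class f \<Longrightarrow> smooth_class (\<lambda>x. f (c * x + d))"

text \<open>Only x = 0 is delicate. There the right difference quotient is exp (- 1 / h) / h ^ (k +
  1), and the substitution h = 1 / x turns it into x ^ (k + 1) / exp x, which tends to 0.\<close>

lemma DERIV_flat:
  fixes k :: nat
  defines "\<tau> \<equiv> \<lambda>k x::real. if 0 < x then exp (- (1 / x)) / x ^ k else 0"
  shows "(\<tau> k has_real_derivative \<tau> (k + 2) x - real k * \<tau> (k + 1) x) (at x)"
proof -
  consider "0 < x" | "x < 0" | "x = 0" by linarith
  then show ?thesis
  proof cases
    case 1
    have "((\<lambda>x. exp (- (1 / x)) / x ^ k) has_real_derivative
        (exp (- (1 / x)) * (1 / x\<^sup>2) * x ^ k - exp (- (1 / x)) * (real k * x ^ (k - 1))) / (x ^ k * x ^ k)) (at x)"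
      using 1 by (auto intro!: derivative_eq_intros simp: power2_eq_square)
    also have "(exp (- (1 / x)) * (1 / x\<^sup>2) * x ^ k - exp (- (1 / x)) * (real k * x ^ (k - 1))) / (x ^ k * x ^ k)
      = \<tau> (k + 2) x - real k * \<tau> (k + 1) x"
      using 1 by (cases k) (simp_all add: \<tau>_def field_simps power2_eq_square)
    finally show ?thesis
      by (rule has_field_derivative_transform_within_open[where S = "{0<..}"]) (use 1 in \<open>auto simp: \<tau>_def\<close>)
  next
    case 2
    have "((\<lambda>_. 0) has_real_derivative \<tau> (k + 2) x - real k * \<tau> (k + 1) x) (at x)"
      using 2 by (simp add: \<tau>_def)
    then show ?thesis
      by (rule has_field_derivative_transform_within_open[where S = "{..<0}"]) (use 2 in \<open>auto simp: \<tau>_def\<close>)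
  next
    case 3
    have "((\<lambda>h. exp (- (1 / h)) / h ^ k / h) \<longlongrightarrow> (0::real)) (at_right 0)"
      unfolding filterlim_at_right_to_top
    proof (rule Lim_transform_eventually[OF tendsto_power_div_exp_0[of "Suc k"]])
      show "\<forall>\<^sub>F x::real in at_top. x ^ Suc k / exp x = exp (- (1 / inverse x)) / inverse x ^ k / inverse x"
        by (rule eventually_mono[OF eventually_gt_at_top[of "0::real"]]) (simp add: field_simps exp_minus)
    qed
    then have right: "((\<lambda>h. (\<tau> k h - \<tau> k 0) / (h - 0)) \<longlongrightarrow> 0) (at_right 0)"
      by (rule Lim_transform_eventually) (auto simp: \<tau>_def eventually_at_filter)
    have left: "((\<lambda>h. (\<tau> k h - \<tau> k 0) / (h - 0)) \<longlongrightarrow> 0) (at_left 0)"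
      by (rule Lim_transform_eventually[OF tendsto_const]) (auto simp: \<tau>_def eventually_at_filter)
    have "(\<tau> k has_real_derivative 0) (at 0)"
      unfolding has_field_derivative_iff using left right by (simp add: filterlim_split_at)
    then show ?thesis using 3 by (simp add: \<tau>_def)
  qed
qed

lemma smooth_class_deriv:
  assumes "smooth_class f"
  shows "\<exists>g. smooth_class g \<and> (\<forall>x. (f has_real_derivative g x) (at x))"
  using assms
proof (induction rule: smooth_class.induct)
  case (flat k)
  show ?case
    using DERIV_flat[of k] smooth_class.intros(3)[OF smooth_class.flat[of "k + 2"] smooth_class.mult[OF smooth_class.const[of "- real k"] smooth_class.flat[of "k + 1"]]]
    by (intro exI conjI allI) (assumption, simp)
next
  case (const c)
  show ?case using smooth_class.const[of 0] by (intro exI[of _ "\<lambda>_. 0"]) simp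
next
  case (add f g)
  then obtain f' g' where "smooth_class f'" "smooth_class g'"
    "\<And>x. (f has_real_derivative f' x) (at x)" "\<And>x. (g has_real_derivative g' x) (at x)" by blast
  then show ?case
    by (intro exI[of _ "\<lambda>x. f' x + g' x"]) (auto intro!: smooth_class.add derivative_eq_intros)
next
  case (mult f g)
  then obtain f' g' where "smooth_class f'" "smooth_class g'"
    "\<And>x. (f has_real_derivative f' x) (at x)" "\<And>x. (g has_real_derivative g' x) (at x)" by blast
  with mult show ?case
    by (intro exI[of _ "\<lambda>x. f' x * g x + f x * g' x"])
      (auto intro!: smooth_class.add smooth_class.mult derivative_eq_intros)
next
  case (exp f)
  then obtain f' where "smooth_class f'" "\<And>x. (f has_real_derivative f' x) (at x)" by blast
  with exp show ?case
    by (intro exI[of _ "\<lambda>x. exp (f x) * f' x"])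
      (auto intro!: smooth_class.exp smooth_class.mult derivative_eq_intros)
next
  case (affine f c d)
  then obtain f' where f': "smooth_class f'" "\<And>x. (f has_real_derivative f' x) (at x)" by blast
  have "((\<lambda>x. c * x + d) has_real_derivative c) (at x)" for x
    by (auto intro!: derivative_eq_intros)
  then have "((\<lambda>x. f (c * x + d)) has_real_derivative f' (c * x + d) * c) (at x)" for x
    by (intro DERIV_chain2[OF f'(2)])
  then show ?case
    using smooth_class.mult[OF smooth_class.affine[OF f'(1), of c d] smooth_class.const[of c]] by blast
qed

lemma smooth_class_imp_smooth_fun:
  assumes "smooth_class f"
  shows "smooth_fun f"
proof -
  have "smooth_class ((deriv ^^ n) f)" for n
  proof (induction n)
    case (Suc n)
    then obtain g where "smooth_class g" "\<And>x. ((deriv ^^ n) f has_real_derivative g x) (at x)"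
      using smooth_class_deriv by blast
    moreover from this have "deriv ((deriv ^^ n) f) = g" by (auto intro: DERIV_imp_deriv)
    ultimately show ?case by simp
  qed (simp add: assms)
  then show ?thesis
    unfolding smooth_fun_def using smooth_class_deriv by (meson real_differentiable_def)
qed

section \<open>Weak derivatives\<close>

text \<open>This is the oriented integral from 0. \<open>primitive\<close> integrates over a set and
  gives 0 when the limits are reversed, so the sign for negative arguments is put in by
  hand.\<close>

definition antiderivative :: "(real \<Rightarrow> real) \<Rightarrow> real \<Rightarrow> real" where
  "antiderivative g x = (if 0 \<le> x then primitive g 0 x else - primitive g x 0)"

lemma borel_measurable_antiderivative [measurable]:
  assumes [measurable]: "g \<in> borel_measurable borel"
  shows "antiderivative g \<in> borel_measurable borel"
proof -
  have "(\<lambda>x. primitive g x 0) = (\<lambda>x. LINT t|lborel. (if x \<le> t \<and> t \<le> 0 then g t else 0))"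
    unfolding primitive_def set_lebesgue_integral_def
    by (intro ext Bochner_Integration.integral_cong) auto
  then have [measurable]: "(\<lambda>x. primitive g x 0) \<in> borel_measurable borel" by simp
  show ?thesis unfolding antiderivative_def[abs_def] by measurable
qed

lemma antiderivative_eq:
  assumes g: "\<And>a b. set_integrable lborel {a..b} g" and "0 < M" "- M \<le> x"
  shows "antiderivative g x = antiderivative g (- M) + primitive g (- M) x"
proof (cases "0 \<le> x")
  case True
  then show ?thesis
    using primitive_split[OF g, of "- M" 0 x] assms(2,3) by (simp add: antiderivative_def)
next
  case False
  then show ?thesis
    using primitive_split[OF g, of "- M" x 0] assms(2,3) by (simp add: antiderivative_def)
qed

lemma integrable_mult_compact_support:
  fixes f h :: "real \<Rightarrow> real"
  assumes f: "\<And>a b. set_integrable lborel {a..b} f" and [measurable]: "f \<in> borel_measurable borel"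
    and h: "\<And>x. isCont h x" and supp: "\<And>x. M \<le> \<bar>x\<bar> \<Longrightarrow> h x = 0"
  shows "integrable lborel (\<lambda>x. f x * h x)"
proof -
  have [measurable]: "h \<in> borel_measurable borel"
    using h by (intro borel_measurable_continuous_onI continuous_at_imp_continuous_on) auto
  have "compact (h ` {- M..M})"
    using h by (intro compact_continuous_image continuous_at_imp_continuous_on) auto
  then obtain K where K: "\<And>x. - M \<le> x \<Longrightarrow> x \<le> M \<Longrightarrow> \<bar>h x\<bar> \<le> K"
    using compact_imp_bounded[of "h ` {- M..M}"] unfolding bounded_iff
    by (metis atLeastAtMost_iff image_eqI real_norm_def)
  show ?thesis
  proof (rule Bochner_Integration.integrable_bound)
    show "integrable lborel (\<lambda>x. indicator {- M..M} x *\<^sub>R f x * K)"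
      using f[of "- M" M] by (simp add: set_integrable_def)
    show "AE x in lborel. norm (f x * h x) \<le> norm (indicator {- M..M} x *\<^sub>R f x * K)"
    proof (rule AE_I2)
      fix x
      show "norm (f x * h x) \<le> norm (indicator {- M..M} x *\<^sub>R f x * K)"
      proof (cases "x \<in> {- M..M}")
        case True
        then have "\<bar>h x\<bar> \<le> \<bar>K\<bar>" using K[of x] by auto
        then show ?thesis using True by (simp add: abs_mult mult_left_mono)
      next
        case False
        then have "h x = 0" by (intro supp) auto
        then show ?thesis by simp
      qed
    qed
  qed simp
qed

lemma abs_primitive_le:
  assumes g: "\<And>a b. set_integrable lborel {a..b} g" and "c \<le> a" "x \<le> d"
  shows "\<bar>primitive g a x\<bar> \<le> (LINT t:{c..d}|lborel. \<bar>g t\<bar>)"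
proof -
  have "norm (LINT t|lborel. indicator {a..x} t *\<^sub>R g t) \<le> (LINT t|lborel. indicator {c..d} t *\<^sub>R \<bar>g t\<bar>)"
  proof (rule Bochner_Integration.integral_norm_bound_integral)
    show "integrable lborel (\<lambda>t. indicator {a..x} t *\<^sub>R g t)"
      using g by (simp add: set_integrable_def)
    show "integrable lborel (\<lambda>t. indicator {c..d} t *\<^sub>R \<bar>g t\<bar>)"
      using set_integrable_abs[OF g[of c d]] by (simp add: set_integrable_def)
    show "norm (indicat_real {a..x} t *\<^sub>R g t) \<le> indicat_real {c..d} t *\<^sub>R \<bar>g t\<bar>" for t
      using assms(2,3) by (auto split: split_indicator)
  qed
  then show ?thesis by (simp add: primitive_def set_lebesgue_integral_def)
qed

lemma set_integrable_antiderivative: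
  assumes g: "\<And>a b. set_integrable lborel {a..b} g" and [measurable]: "g \<in> borel_measurable borel"
  shows "set_integrable lborel {a..b} (antiderivative g)"
proof -
  define M where "M = max \<bar>a\<bar> \<bar>b\<bar>"
  define K where "K = (LINT t:{- M..M}|lborel. \<bar>g t\<bar>)"
  have K: "\<bar>antiderivative g x\<bar> \<le> K" if "- M \<le> x" "x \<le> M" for x
    unfolding antiderivative_def K_def
    using abs_primitive_le[OF g, of "- M" 0 x M] abs_primitive_le[OF g, of "- M" x 0 M] that by auto
  have "set_integrable lborel {a..b} (\<lambda>x. if x \<in> {- M..M} then antiderivative g x else 0)"
  proof (rule set_integrable_bounded[where L = "\<bar>K\<bar>"])
    show "\<bar>if x \<in> {- M..M} then antiderivative g x else 0\<bar> \<le> \<bar>K\<bar>" for x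
      using K[of x] by auto
  qed measurable
  moreover have "set_integrable lborel {a..b} (\<lambda>x. if x \<in> {- M..M} then antiderivative g x else 0)
      \<longleftrightarrow> set_integrable lborel {a..b} (antiderivative g)"
    by (rule set_integrable_cong) (auto simp: M_def)
  ultimately show ?thesis by simp
qed

text \<open>As \<open>g\<close> is only locally integrable, its antiderivative need not be
  differentiable at every point. Fubini on the triangle - M \<le> t \<le> x \<le> M replaces the
  product rule: the inner integral of \<phi>' over [t, M] is - \<phi> t.\<close>

lemma antiderivative_by_parts:
  fixes \<phi> \<phi>' :: "real \<Rightarrow> real"
  assumes g: "\<And>a b. set_integrable lborel {a..b} g" and [measurable]: "g \<in> borel_measurable borel"
    and \<phi>: "\<And>x. (\<phi> has_real_derivative \<phi>' x) (at x)" and cont: "\<And>x. isCont \<phi>' x" and M: "0 < M"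
    and supp: "\<And>x. M \<le> \<bar>x\<bar> \<Longrightarrow> \<phi> x = 0" "\<And>x. M \<le> \<bar>x\<bar> \<Longrightarrow> \<phi>' x = 0"
  shows "(LINT x|lborel. antiderivative g x * \<phi>' x) = - (LINT x|lborel. g x * \<phi> x)"
proof -
  have [measurable]: "\<phi>' \<in> borel_measurable borel" "\<phi> \<in> borel_measurable borel"
    using cont DERIV_isCont[OF \<phi>] by (auto intro!: borel_measurable_continuous_onI continuous_at_imp_continuous_on)
  have FTC: "(LINT x|lborel. \<phi>' x * indicator {t..M} x) = - \<phi> t" if "t \<le> M" for t
    using integral_FTC_Icc_real[of t M \<phi> \<phi>'] that \<phi> cont supp(1)[of M] M by simp
  define H where "H x t = (if - M \<le> t \<and> t \<le> x \<and> x \<le> M then g t * \<phi>' x else 0)" for x t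
  have mH [measurable]: "case_prod H \<in> borel_measurable (lborel \<Otimes>\<^sub>M lborel)"
    unfolding H_def case_prod_beta by measurable
  have Hx: "H x t = \<phi>' x * (indicator {- M..x} t *\<^sub>R g t)" for x t
    using supp(2)[of x] by (auto simp: H_def split: split_indicator)
  have Ht: "H x t = indicator {- M..M} t *\<^sub>R g t * (\<phi>' x * indicator {t..M} x)" for x t
    by (auto simp: H_def split: split_indicator)
  have I1: "integrable lborel (\<lambda>t. H x t)" for x
    unfolding Hx using g[of "- M" x] by (simp add: set_integrable_def)
  define K where "K = (LINT t:{- M..M}|lborel. \<bar>g t\<bar>)"
  have I2: "integrable lborel (\<lambda>x. LINT t|lborel. norm (H x t))"
  proof (rule Bochner_Integration.integrable_bound)
    show "integrable lborel (\<lambda>x. K * \<phi>' x)"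
      by (rule integrable_mult_compact_support[where M = M])
        (use cont supp set_integrable_bounded[of "\<lambda>_. K" "\<bar>K\<bar>"] in auto)
    show "AE x in lborel. norm (LINT t|lborel. norm (H x t)) \<le> norm (K * \<phi>' x)"
    proof (rule AE_I2)
      fix x
      have "norm (LINT t|lborel. norm (H x t)) = (LINT t|lborel. norm (H x t))" by simp
      also have "\<dots> \<le> (LINT t|lborel. \<bar>\<phi>' x\<bar> * (indicator {- M..M} t *\<^sub>R \<bar>g t\<bar>))"
      proof (rule integral_mono)
        show "integrable lborel (\<lambda>t. norm (H x t))" by (intro integrable_norm I1)
        show "integrable lborel (\<lambda>t. \<bar>\<phi>' x\<bar> * (indicat_real {- M..M} t *\<^sub>R \<bar>g t\<bar>))"
          using set_integrable_abs[OF g[of "- M" M]] by (simp add: set_integrable_def)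
        show "norm (H x t) \<le> \<bar>\<phi>' x\<bar> * (indicat_real {- M..M} t *\<^sub>R \<bar>g t\<bar>)" for t
          by (auto simp: H_def abs_mult split: split_indicator)
      qed
      also have "\<dots> = \<bar>\<phi>' x\<bar> * K" by (simp add: K_def set_lebesgue_integral_def)
      also have "\<dots> \<le> norm (K * \<phi>' x)" by (simp add: abs_mult mult.commute mult_right_mono)
      finally show "norm (LINT t|lborel. norm (H x t)) \<le> norm (K * \<phi>' x)" .
    qed
  qed simp
  have int: "integrable (lborel \<Otimes>\<^sub>M lborel) (case_prod H)"
    by (rule lborel_pair.Fubini_integrable) (use I1 I2 in auto)
  \<comment> \<open>Moving the base point from 0 to - M covers the whole support with one
    orientation; the extra constant multiplies the integral of \<phi>', which is 0.\<close>
  have "(LINT x|lborel. antiderivative g x * \<phi>' x)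
      = (LINT x|lborel. antiderivative g (- M) * \<phi>' x + (LINT t|lborel. H x t))"
  proof (rule Bochner_Integration.integral_cong)
    fix x
    show "antiderivative g x * \<phi>' x = antiderivative g (- M) * \<phi>' x + (LINT t|lborel. H x t)"
    proof (cases "- M \<le> x")
      case True
      then show ?thesis
        using antiderivative_eq[OF g M True]
        by (simp add: Hx primitive_def set_lebesgue_integral_def algebra_simps)
    next
      case False
      then have "\<phi>' x = 0" using M by (intro supp) auto
      then show ?thesis by (simp add: Hx)
    qed
  qed simp
  also have "\<dots> = antiderivative g (- M) * (LINT x|lborel. \<phi>' x) + (LINT x|lborel. LINT t|lborel. H x t)"
  proof (subst Bochner_Integration.integral_add)
    show "integrable lborel (\<lambda>x. antiderivative g (- M) * \<phi>' x)"
      by (rule integrable_mult_compact_support[where M = M])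
        (use cont supp set_integrable_bounded[of "\<lambda>_. antiderivative g (- M)" "\<bar>antiderivative g (- M)\<bar>"] in auto)
    show "integrable lborel (\<lambda>x. LINT t|lborel. H x t)"
      using lborel_pair.integrable_fst'[OF int] by simp
  qed simp
  also have "(LINT x|lborel. \<phi>' x) = 0"
  proof -
    have "(LINT x|lborel. \<phi>' x) = (LINT x|lborel. \<phi>' x * indicator {- M..M} x)"
      by (intro Bochner_Integration.integral_cong) (auto simp: supp split: split_indicator)
    then show ?thesis using FTC[of "- M"] supp(1)[of "- M"] M by simp
  qed
  also have "(LINT x|lborel. LINT t|lborel. H x t) = (LINT t|lborel. LINT x|lborel. H x t)"
    by (rule lborel_pair.Fubini_integral[symmetric]) (rule int)
  also have "\<dots> = (LINT t|lborel. - (g t * \<phi> t))"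
  proof (rule Bochner_Integration.integral_cong)
    fix t
    show "(LINT x|lborel. H x t) = - (g t * \<phi> t)"
    proof (cases "t \<in> {- M..M}")
      case True
      then show ?thesis using FTC[of t] by (simp add: Ht)
    next
      case False
      then have "\<phi> t = 0" by (intro supp) auto
      with False show ?thesis by (simp add: Ht)
    qed
  qed simp
  finally show ?thesis by simp
qed

lemma test_fun_support:
  assumes "test_fun \<phi>"
  obtains M where "0 < M" "\<And>x. M \<le> \<bar>x\<bar> \<Longrightarrow> \<phi> x = 0" "\<And>x. M \<le> \<bar>x\<bar> \<Longrightarrow> deriv \<phi> x = 0"
proof -
  have "bounded {x. \<phi> x \<noteq> 0}"
    using assms unfolding test_fun_def
    by (meson bounded_subset closure_subset compact_imp_bounded)
  then obtain R where R: "0 < R" "\<And>x. \<phi> x \<noteq> 0 \<Longrightarrow> \<bar>x\<bar> \<le> R"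
    by (auto simp: bounded_pos)
  \<comment> \<open>The margin 1 guarantees a two-sided neighbourhood of x on which \<phi>
    vanishes.\<close>
  have "deriv \<phi> x = 0" if "R + 1 \<le> \<bar>x\<bar>" for x
  proof -
    have "(\<phi> has_real_derivative 0) (at x)"
    proof (rule has_field_derivative_transform_within_open[of "\<lambda>_. 0" 0 x "- {- R..R}"])
      show "x \<in> - {- R..R}" using that R(1) by auto
      show "0 = \<phi> y" if "y \<in> - {- R..R}" for y
        using R(2)[of y] that by fastforce
    qed auto
    then show ?thesis by (rule DERIV_imp_deriv)
  qed
  moreover have "\<phi> x = 0" if "R + 1 \<le> \<bar>x\<bar>" for x
    using R(2)[of x] that by fastforce
  ultimately show ?thesis using that[of "R + 1"] R(1) by auto
qed

lemma test_fun_deriv: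
  assumes "test_fun \<phi>"
  shows "(\<phi> has_real_derivative deriv \<phi> x) (at x)" "isCont \<phi> x" "isCont (deriv \<phi>) x"
proof -
  have s: "((deriv ^^ n) \<phi>) differentiable (at x)" for n x
    using assms by (simp add: test_fun_def smooth_fun_def)
  show "(\<phi> has_real_derivative deriv \<phi> x) (at x)"
    using s[of 0 x] by (simp add: DERIV_deriv_iff_real_differentiable)
  then show "isCont \<phi> x" by (rule DERIV_isCont)
  show "isCont (deriv \<phi>) x"
    using s[of 1 x] by (simp add: differentiable_imp_continuous_within)
qed

section \<open>Test functions with prescribed derivative and the du Bois-Reymond lemma\<close>

lemma exists_test_fun:
  assumes \<theta>: "smooth_class \<theta>" and N: "0 < N" and supp: "\<And>x. N \<le> \<bar>x\<bar> \<Longrightarrow> \<theta> x = 0"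
    and zero: "(LINT x|lborel. \<theta> x) = 0"
  shows "\<exists>\<phi>. test_fun \<phi> \<and> deriv \<phi> = \<theta>"
proof -
  have cont: "isCont \<theta> x" for x
    using smooth_class_deriv[OF \<theta>] DERIV_isCont by blast
  obtain F where F: "\<And>x. (F has_real_derivative \<theta> x) (at x)"
    using einterval_antiderivative[of "- \<infinity>" \<infinity> \<theta>] cont
    by (auto simp: has_real_derivative_iff_has_vector_derivative)
  define \<phi> where "\<phi> x = F x - F (- N)" for x
  have D: "(\<phi> has_real_derivative \<theta> x) (at x)" for x
    unfolding \<phi>_def by (auto intro!: derivative_eq_intros F)
  then have deriv: "deriv \<phi> = \<theta>" by (intro ext DERIV_imp_deriv)
  have FTC: "(LINT x|lborel. \<theta> x * indicator {s..t} x) = F t - F s" if "s \<le> t" for s t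
    using integral_FTC_Icc_real[of s t F \<theta>] that F cont by simp
  have "F N - F (- N) = (LINT x|lborel. \<theta> x)"
    unfolding FTC[of "- N" N, symmetric, OF order_trans[of _ 0]]
    using N by (subst FTC[symmetric]) (auto intro!: Bochner_Integration.integral_cong simp: supp split: split_indicator)
  then have FN: "F N = F (- N)" using zero by simp
  have 0: "\<phi> x = 0" if "N \<le> \<bar>x\<bar>" for x
  proof (cases "0 \<le> x")
    case True
    then have "F x - F N = (LINT y|lborel. \<theta> y * indicator {N..x} y)"
      using that by (subst FTC) auto
    also have "(\<lambda>y. \<theta> y * indicator {N..x} y) = (\<lambda>_. 0)"
      using N by (auto simp: supp split: split_indicator)
    finally show ?thesis using FN by (simp add: \<phi>_def)
  next
    case False
    then have "F (- N) - F x = (LINT y|lborel. \<theta> y * indicator {x..- N} y)"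
      using that by (subst FTC) auto
    also have "(\<lambda>y. \<theta> y * indicator {x..- N} y) = (\<lambda>_. 0)"
      using N by (auto simp: supp split: split_indicator)
    finally show ?thesis by (simp add: \<phi>_def)
  qed
  have "smooth_fun \<phi>"
    unfolding smooth_fun_def
  proof (intro allI)
    fix n x
    show "(deriv ^^ n) \<phi> differentiable at x"
    proof (cases n)
      case 0
      then show ?thesis using D real_differentiable_def by auto
    next
      case (Suc m)
      then have "(deriv ^^ n) \<phi> = (deriv ^^ m) \<theta>" by (simp add: funpow_swap1 deriv)
      then show ?thesis using smooth_class_imp_smooth_fun[OF \<theta>] by (simp add: smooth_fun_def)
    qed
  qed
  moreover have "{x. \<phi> x \<noteq> 0} \<subseteq> {- N..N}"
    using 0 by (auto simp: not_le[symmetric] abs_le_iff) (smt (verit))+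
  then have "bounded {x. \<phi> x \<noteq> 0}" by (rule bounded_subset[OF bounded_closed_interval])
  then have "compact (closure {x. \<phi> x \<noteq> 0})" by simp
  ultimately show ?thesis using deriv by (auto simp: test_fun_def)
qed

text \<open>
  Smooth, supported in \<open>[a, b]\<close>, and increasing to the indicator of \<open>(a, b)\<close> as \<open>n\<close> grows.
\<close>

definition bump :: "nat \<Rightarrow> real \<Rightarrow> real \<Rightarrow> real \<Rightarrow> real" where
  "bump n a b x = (let \<sigma> = (\<lambda>x. if 0 < x then exp (- (1 / x)) else 0)
     in 1 - exp (- (real n * (\<sigma> (x - a) * \<sigma> (b - x)))))"

lemma smooth_class_bump: "smooth_class (bump n a b)"
proof -
  define \<sigma> :: "real \<Rightarrow> real" where "\<sigma> = (\<lambda>x. if 0 < x then exp (- (1 / x)) else 0)"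
  have "smooth_class \<sigma>" using smooth_class.flat[of 0] by (simp add: \<sigma>_def cong: if_cong)
  then have "smooth_class (\<lambda>x. 1 + (- 1) * exp ((- real n) * (\<sigma> (1 * x + (- a)) * \<sigma> ((- 1) * x + b))))"
    by (intro smooth_class.intros)
  then show ?thesis by (simp add: bump_def[abs_def] \<sigma>_def[symmetric])
qed

lemma bump_bounds: "0 \<le> bump n a b x" "bump n a b x \<le> 1"
  by (auto simp: bump_def Let_def)

lemma bump_outside: "x \<notin> {a<..<b} \<Longrightarrow> bump n a b x = 0"
  by (auto simp: bump_def Let_def)

lemma bump_tendsto: "(\<lambda>n. bump n a b x) \<longlonglongrightarrow> indicator {a<..<b} x"
proof (cases "x \<in> {a<..<b}")
  case True
  define c where "c = exp (- (1 / (x - a))) * exp (- (1 / (b - x)))"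
  have "0 < c" by (simp add: c_def)
  then have "filterlim (\<lambda>n. c * real n) at_top sequentially"
    by (intro filterlim_tendsto_pos_mult_at_top[OF tendsto_const] filterlim_real_sequentially)
  then have "filterlim (\<lambda>n. - (c * real n)) at_bot sequentially"
    by (rule filterlim_compose[OF filterlim_uminus_at_bot_at_top])
  then have "(\<lambda>n. exp (- (c * real n))) \<longlonglongrightarrow> 0"
    by (rule filterlim_compose[OF exp_at_bot])
  then have "(\<lambda>n. 1 - exp (- (c * real n))) \<longlonglongrightarrow> 1 - 0" by (intro tendsto_intros)
  then show ?thesis using True by (simp add: bump_def Let_def c_def mult.commute)
qed (simp add: bump_outside)

lemma integral_bump_tendsto:
  assumes f: "\<And>a b. set_integrable lborel {a..b} f" and [measurable]: "f \<in> borel_measurable borel"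
  shows "(\<lambda>n. LINT x|lborel. f x * bump n a b x) \<longlonglongrightarrow> (LINT x:{a<..<b}|lborel. f x)"
proof -
  have "isCont (bump n a b) x" for n x
    using smooth_class_deriv[OF smooth_class_bump] DERIV_isCont by blast
  then have [measurable]: "bump n a b \<in> borel_measurable borel" for n
    by (intro borel_measurable_continuous_onI continuous_at_imp_continuous_on) auto
  have "(\<lambda>n. LINT x|lborel. f x * bump n a b x) \<longlonglongrightarrow> (LINT x|lborel. f x * indicator {a<..<b} x)"
  proof (rule integral_dominated_convergence[where w = "\<lambda>x. indicator {a..b} x *\<^sub>R \<bar>f x\<bar>"])
    show "integrable lborel (\<lambda>x. indicat_real {a..b} x *\<^sub>R \<bar>f x\<bar>)"
      using set_integrable_abs[OF f[of a b]] by (simp add: set_integrable_def)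
    show "AE x in lborel. (\<lambda>n. f x * bump n a b x) \<longlonglongrightarrow> f x * indicator {a<..<b} x"
      by (intro AE_I2 tendsto_intros bump_tendsto)
    show "AE x in lborel. norm (f x * bump n a b x) \<le> indicat_real {a..b} x *\<^sub>R \<bar>f x\<bar>" for n
    proof (rule AE_I2)
      fix x
      show "norm (f x * bump n a b x) \<le> indicat_real {a..b} x *\<^sub>R \<bar>f x\<bar>"
        using bump_bounds[of n a b x] bump_outside[of x a b n]
        by (cases "x \<in> {a<..<b}") (auto simp: abs_mult mult_left_le split: split_indicator)
    qed
  qed simp_all
  then show ?thesis by (simp add: set_lebesgue_integral_def mult.commute)
qed

text \<open>Closed intervals generate the Borel sets, so vanishing integrals spread to every Borel
  set by induction over complements and disjoint unions. Cutting off to [- N, N] supplies the global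
  integrability this requires.\<close>

lemma AE_zero_of_interval_integrals:
  fixes f :: "real \<Rightarrow> real"
  assumes f: "\<And>a b. set_integrable lborel {a..b} f" and [measurable]: "f \<in> borel_measurable borel"
    and zero: "\<And>a b. a < b \<Longrightarrow> (LINT x:{a<..<b}|lborel. f x) = 0"
  shows "AE x in lborel. f x = 0"
proof -
  have zero': "(LINT x:{a..b}|lborel. f x) = 0" for a b
  proof (cases "a < b")
    case True
    have "(LINT x:{a..b}|lborel. f x) = (LINT x:{a<..<b}|lborel. f x)"
      unfolding set_lebesgue_integral_def
    proof (rule integral_cong_AE)
      show "AE x in lborel. indicat_real {a..b} x *\<^sub>R f x = indicat_real {a<..<b} x *\<^sub>R f x"
        using AE_lborel_singleton[of a] AE_lborel_singleton[of b]
        by eventually_elim (auto split: split_indicator)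
    qed simp_all
    then show ?thesis using zero[OF True] by simp
  next
    case False
    have "AE x in lborel. indicat_real {a..b} x *\<^sub>R f x = 0"
      using AE_lborel_singleton[of a] by eventually_elim (use False in \<open>auto split: split_indicator\<close>)
    then show ?thesis unfolding set_lebesgue_integral_def by (rule integral_eq_zero_AE)
  qed
  have "AE x in lborel. indicator {- real N..real N} x *\<^sub>R f x = 0" for N
  proof (rule sigma_finite_measure.density_zero[OF lborel.sigma_finite_measure_axioms])
    let ?h = "\<lambda>x. indicator {- real N..real N} x *\<^sub>R f x"
    show h: "integrable lborel ?h" using f[of "- real N" "real N"] by (simp add: set_integrable_def)
    have hA: "set_integrable lborel A ?h" if "A \<in> sets borel" for A
      using integrable_mult_indicator[OF _ h, of A] that by (simp add: set_integrable_def)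
    fix A :: "real set" assume "A \<in> sets lborel"
    then have "A \<in> sets borel" by simp
    then show "set_lebesgue_integral lborel A ?h = 0"
    proof (induction rule: borel_set_induct)
      case empty
      show ?case by (simp add: set_lebesgue_integral_def)
    next
      case (interval a b)
      have "(LINT x:{a..b}|lborel. ?h x) = (LINT x:{max a (- real N)..min b (real N)}|lborel. f x)"
        unfolding set_lebesgue_integral_def
        by (intro Bochner_Integration.integral_cong) (auto split: split_indicator)
      then show ?case using zero' by simp
    next
      case (compl A)
      have "(LINT x:(A \<union> - A)|lborel. ?h x) = (LINT x:A|lborel. ?h x) + (LINT x:- A|lborel. ?h x)"
        using compl by (intro set_integral_Un hA) auto
      moreover have "(LINT x:(A \<union> - A)|lborel. ?h x) = (LINT x:{- real N..real N}|lborel. f x)"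
        by (simp add: set_lebesgue_integral_def)
      ultimately show ?case using compl zero' by simp
    next
      case (union A)
      have "(LINT x:(\<Union>i. A i)|lborel. ?h x) = (\<Sum>i. (LINT x:(A i)|lborel. ?h x))"
        using union by (intro lebesgue_integral_countable_add hA) (auto simp: disjoint_family_on_def)
      then show ?case using union by simp
    qed
  qed
  then have "AE x in lborel. \<forall>N. indicator {- real N..real N} x *\<^sub>R f x = 0"
    unfolding AE_all_countable by blast
  then show ?thesis
  proof eventually_elim
    case (elim x)
    obtain N where "\<bar>x\<bar> \<le> real N" using real_arch_simple by blast
    then show ?case using elim[rule_format, of N] by (auto simp: abs_le_iff split: split_indicator_asm)
  qed
qed

text \<open>A bump on (a, b), minus the right multiple of one fixed bump, has mean zero and so is
  the derivative of a test function. Orthogonality then makes the integral of v against any bump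
  proportional to the mass of that bump, with the same factor m. In the limit v - m has integral 0
  over every interval.\<close>

lemma du_Bois_Reymond:
  fixes v :: "real \<Rightarrow> real"
  assumes v: "\<And>a b. set_integrable lborel {a..b} v" and [measurable]: "v \<in> borel_measurable borel"
    and orth: "\<And>\<phi>. test_fun \<phi> \<Longrightarrow> (LINT x|lborel. v x * deriv \<phi> x) = 0"
  shows "\<exists>m. AE x in lborel. v x = m"
proof -
  have cont: "isCont (bump n a b) x" for n a b x
    using smooth_class_deriv[OF smooth_class_bump] DERIV_isCont by blast
  have const: "set_integrable lborel {a..b} (\<lambda>_. c)" for a b c :: real
    using borel_integrable_atLeastAtMost'[of a b "\<lambda>_. c"] by simp
  have len: "(LINT x:{a<..<b}|lborel. 1) = b - a" if "a < b" for a b :: real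
    using that by (simp add: set_lebesgue_integral_def)
  have "(\<lambda>n. LINT x|lborel. 1 * bump n 0 1 x) \<longlonglongrightarrow> 1"
    using integral_bump_tendsto[of "\<lambda>_. 1" 0 1, OF const] len[of 0 1] by simp
  then have "\<forall>\<^sub>F n in sequentially. 0 < (LINT x|lborel. 1 * bump n 0 1 x)"
    by (rule order_tendstoD) simp
  then obtain k where k: "0 < (LINT x|lborel. bump k 0 1 x)"
    by (auto dest: eventually_happens)
  define s where "s = (LINT x|lborel. bump k 0 1 x)"
  define m where "m = (LINT x|lborel. v x * bump k 0 1 x) / s"
  have eq: "(LINT x|lborel. v x * bump n a b x) = m * (LINT x|lborel. 1 * bump n a b x)" for n a b
  proof -
    define c where "c = (LINT x|lborel. bump n a b x)"
    define N where "N = max 2 (max \<bar>a\<bar> \<bar>b\<bar>)"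
    have supp: "bump n a b x = 0" "bump k 0 1 x = 0" if "N \<le> \<bar>x\<bar>" for x
      using that by (auto intro!: bump_outside simp: N_def)
    have int: "integrable lborel (\<lambda>x. f x * bump n a b x)" "integrable lborel (\<lambda>x. f x * bump k 0 1 x)"
      if "\<And>a b. set_integrable lborel {a..b} f" "f \<in> borel_measurable borel" for f
      using that cont supp by (auto intro!: integrable_mult_compact_support[where M = N])
    note int1 = int[of "\<lambda>_. 1", OF const, simplified]
    define \<theta> where "\<theta> x = bump n a b x + (- (c / s)) * bump k 0 1 x" for x
    have "\<exists>\<phi>. test_fun \<phi> \<and> deriv \<phi> = \<theta>"
    proof (rule exists_test_fun[of \<theta> N])
      show "smooth_class \<theta>" unfolding \<theta>_def
        by (intro smooth_class.add smooth_class.mult smooth_class.const smooth_class_bump)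
      show "0 < N" by (simp add: N_def)
      show "\<theta> x = 0" if "N \<le> \<bar>x\<bar>" for x using supp[OF that] by (simp add: \<theta>_def)
      show "(LINT x|lborel. \<theta> x) = 0"
        unfolding \<theta>_def using int1 k by (simp add: c_def s_def)
    qed
    then have "(LINT x|lborel. v x * \<theta> x) = 0" using orth by blast
    moreover have "(LINT x|lborel. v x * \<theta> x)
        = (LINT x|lborel. v x * bump n a b x + (- (c / s)) * (v x * bump k 0 1 x))"
      by (intro Bochner_Integration.integral_cong) (auto simp: \<theta>_def algebra_simps)
    ultimately have "(LINT x|lborel. v x * bump n a b x) = (c / s) * (LINT x|lborel. v x * bump k 0 1 x)"
      using int[OF v] by simp
    then show ?thesis by (simp add: m_def c_def)
  qed
  have zero: "(LINT x:{a<..<b}|lborel. v x - m) = 0" if "a < b" for a b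
  proof -
    have "(\<lambda>n. LINT x|lborel. v x * bump n a b x) \<longlonglongrightarrow> m * (b - a)"
      unfolding eq using integral_bump_tendsto[of "\<lambda>_. 1" a b, OF const] len[OF that]
      by (intro tendsto_intros) simp
    moreover have "(\<lambda>n. LINT x|lborel. v x * bump n a b x) \<longlonglongrightarrow> (LINT x:{a<..<b}|lborel. v x)"
      by (intro integral_bump_tendsto v) simp
    ultimately have "(LINT x:{a<..<b}|lborel. v x) = m * (b - a)"
      using LIMSEQ_unique by blast
    moreover have "(LINT x:{a<..<b}|lborel. v x - m) = (LINT x:{a<..<b}|lborel. v x) - (LINT x:{a<..<b}|lborel. m)"
      by (intro set_integral_diff) (auto intro: set_integrable_subset[OF v[of a b]] set_integrable_subset[OF const[of a b]])
    moreover have "(LINT x:{a<..<b}|lborel. m) = m * (b - a)"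
      using that by (simp add: set_lebesgue_integral_def)
    ultimately show ?thesis by simp
  qed
  have "AE x in lborel. v x - m = 0"
    by (rule AE_zero_of_interval_integrals) (use zero v const in \<open>auto intro: set_integral_diff\<close>)
  then show ?thesis by (intro exI[of _ m]) auto
qed

text \<open>Both u and the antiderivative have weak derivative g, so their difference is orthogonal
  to every derivative of a test function and hence is constant almost everywhere.\<close>

lemma weak_deriv_imp_antiderivative:
  assumes w: "weak_deriv u g" and [measurable]: "u \<in> borel_measurable borel" "g \<in> borel_measurable borel"
  shows "\<exists>c. AE x in lborel. u x = c + antiderivative g x"
proof -
  have u: "set_integrable lborel {a..b} u" and g: "set_integrable lborel {a..b} g" for a b
    using w compact_Icc[of a b] unfolding weak_deriv_def by blast+
  have G: "set_integrable lborel {a..b} (antiderivative g)" for a b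
    by (rule set_integrable_antiderivative[OF g]) simp
  have "\<exists>m. AE x in lborel. u x - antiderivative g x = m"
  proof (rule du_Bois_Reymond)
    show "set_integrable lborel {a..b} (\<lambda>x. u x - antiderivative g x)" for a b
      by (intro set_integral_diff u G)
    fix \<phi> assume \<phi>: "test_fun \<phi>"
    obtain M where M: "0 < M" "\<And>x. M \<le> \<bar>x\<bar> \<Longrightarrow> \<phi> x = 0" "\<And>x. M \<le> \<bar>x\<bar> \<Longrightarrow> deriv \<phi> x = 0"
      using test_fun_support[OF \<phi>] by metis
    have "(LINT x|lborel. (u x - antiderivative g x) * deriv \<phi> x)
      = (LINT x|lborel. u x * deriv \<phi> x) - (LINT x|lborel. antiderivative g x * deriv \<phi> x)"
      unfolding left_diff_distrib
      by (intro Bochner_Integration.integral_diff integrable_mult_compact_support[where M = M] u G)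
        (use M test_fun_deriv[OF \<phi>] in auto)
    also have "(LINT x|lborel. antiderivative g x * deriv \<phi> x) = - (LINT x|lborel. g x * \<phi> x)"
      by (rule antiderivative_by_parts[where M = M]) (use g M test_fun_deriv[OF \<phi>] in auto)
    also have "(LINT x|lborel. u x * deriv \<phi> x) = - (LINT x|lborel. g x * \<phi> x)"
      using w \<phi> unfolding weak_deriv_def by blast
    finally show "(LINT x|lborel. (u x - antiderivative g x) * deriv \<phi> x) = 0" by simp
  qed simp
  then obtain m where "AE x in lborel. u x - antiderivative g x = m" ..
  then have "AE x in lborel. u x = m + antiderivative g x" by eventually_elim simp
  then show ?thesis ..
qed

text \<open>Admits the merely Lipschitz test functions of the lower bound to
  \<open>H1\<close>.\<close>

lemma weak_deriv_antiderivative: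
  assumes g: "\<And>a b. set_integrable lborel {a..b} g" and [measurable]: "g \<in> borel_measurable borel"
  shows "weak_deriv (antiderivative g) g"
  unfolding weak_deriv_def
proof (intro conjI allI impI)
  have G: "set_integrable lborel {a..b} (antiderivative g)" for a b
    by (rule set_integrable_antiderivative[OF g]) simp
  fix K :: "real set" assume K: "compact K"
  then obtain a b where ab: "K \<subseteq> {a..b}"
    by (metis bounded_subset_cbox_symmetric compact_imp_bounded cbox_interval)
  have "K \<in> sets borel" using K by (simp add: borel_closed compact_imp_closed)
  then show "set_integrable lborel K (antiderivative g)" "set_integrable lborel K g"
    using set_integrable_subinterval[OF G _ ab] set_integrable_subinterval[OF g _ ab] by auto
next
  fix \<phi> assume \<phi>: "test_fun \<phi>"
  obtain M where M: "0 < M" "\<And>x. M \<le> \<bar>x\<bar> \<Longrightarrow> \<phi> x = 0" "\<And>x. M \<le> \<bar>x\<bar> \<Longrightarrow> deriv \<phi> x = 0"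
    using test_fun_support[OF \<phi>] by metis
  show "(LINT x|lborel. antiderivative g x * deriv \<phi> x) = - (LINT x|lborel. g x * \<phi> x)"
    by (rule antiderivative_by_parts[where M = M]) (use g M test_fun_deriv[OF \<phi>] in auto)
qed

section \<open>Bounds for the Poincare constant\<close>

lemma primitive_reflect: "primitive (\<lambda>t. g (- t)) 0 x = primitive g (- x) 0"
proof -
  have "primitive g (- x) 0 = (LINT t|lborel. indicator {- x..0} (- t) *\<^sub>R g (- t))"
    unfolding primitive_def set_lebesgue_integral_def
    using lborel_integral_real_affine[of "-1" "\<lambda>t. indicator {- x..0} t *\<^sub>R g t" 0] by simp
  also have "\<dots> = primitive (\<lambda>t. g (- t)) 0 x"
    unfolding primitive_def set_lebesgue_integral_def
    by (intro Bochner_Integration.integral_cong) (auto split: split_indicator)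
  finally show ?thesis by simp
qed

lemma set_integrable_reflect:
  fixes g :: "real \<Rightarrow> real"
  assumes "set_integrable lborel {- b..- a} g"
  shows "set_integrable lborel {a..b} (\<lambda>t. g (- t))"
proof -
  have "integrable lborel (\<lambda>t. indicator {- b..- a} (0 + -1 * t) *\<^sub>R g (0 + -1 * t))"
    using assms unfolding set_integrable_def by (intro lborel_integrable_real_affine) auto
  also have "(\<lambda>t. indicator {- b..- a} (0 + -1 * t) *\<^sub>R g (0 + -1 * t)) = (\<lambda>t. indicator {a..b} t *\<^sub>R g (- t))"
    by (auto split: split_indicator)
  finally show ?thesis by (simp add: set_integrable_def)
qed

lemma hardy_primitive:
  assumes sup: "supersolution lam 0 A B" and lam: "0 < lam"
    and g: "\<And>a b. set_integrable lborel {a..b} g" and [measurable]: "g \<in> borel_measurable borel"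
  shows "(\<integral>\<^sup>+x. ennreal ((primitive g 0 x)\<^sup>2 * dens x) * indicator {0..} x \<partial>lborel)
    \<le> ennreal (1 / lam) * (\<integral>\<^sup>+t. ennreal ((g t)\<^sup>2 * dens t) * indicator {0..} t \<partial>lborel)"
proof (rule order_trans[OF nn_integral_mono hardy_halfline[OF sup lam]])
  fix x
  have "ennreal (norm (primitive g 0 x)) \<le> (\<integral>\<^sup>+t. norm (indicator {0..x} t *\<^sub>R g t) \<partial>lborel)"
    unfolding primitive_def set_lebesgue_integral_def
    using g by (intro integral_norm_bound_ennreal) (simp add: set_integrable_def)
  also have "\<dots> = (\<integral>\<^sup>+t. ennreal \<bar>g t\<bar> * indicator {0..x} t \<partial>lborel)"
    by (intro nn_integral_cong) (auto split: split_indicator)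
  finally have "ennreal (norm (primitive g 0 x)) ^ 2 \<le> (\<integral>\<^sup>+t. ennreal \<bar>g t\<bar> * indicator {0..x} t \<partial>lborel) ^ 2"
    by (intro power_mono) auto
  then have "ennreal ((primitive g 0 x)\<^sup>2) \<le> (\<integral>\<^sup>+t. ennreal \<bar>g t\<bar> * indicator {0..x} t \<partial>lborel)\<^sup>2"
    by (simp add: ennreal_power)
  then show "ennreal ((primitive g 0 x)\<^sup>2 * dens x) * indicator {0..} x
    \<le> (\<integral>\<^sup>+t. ennreal \<bar>g t\<bar> * indicator {0..x} t \<partial>lborel)\<^sup>2 * ennreal (dens x) * indicator {0..} x"
    using dens_pos[of x] by (auto simp: ennreal_mult less_imp_le intro!: mult_right_mono)
qed simp

lemma nn_integral_reflect:
  fixes f :: "real \<Rightarrow> ennreal"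
  assumes [measurable]: "f \<in> borel_measurable borel"
  shows "(\<integral>\<^sup>+x. f (- x) \<partial>lborel) = (\<integral>\<^sup>+x. f x \<partial>lborel)"
  using nn_integral_real_affine[of f "-1" 0] by simp

text \<open>Since the density is even, the negative half-line is the positive one for the reflected
  function, and one supersolution serves both sides.\<close>

lemma hardy_antiderivative:
  assumes sup: "supersolution lam 0 A B" and lam: "0 < lam"
    and g: "\<And>a b. set_integrable lborel {a..b} g" and [measurable]: "g \<in> borel_measurable borel"
  shows "(\<integral>\<^sup>+x. ennreal ((antiderivative g x)\<^sup>2 * dens x) \<partial>lborel)
    \<le> ennreal (1 / lam) * (\<integral>\<^sup>+t. ennreal ((g t)\<^sup>2 * dens t) \<partial>lborel)"
proof -
  let ?G = "\<lambda>x. ennreal ((primitive g 0 x)\<^sup>2 * dens x) * indicator {0..} x"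
  let ?H = "\<lambda>x. ennreal ((primitive (\<lambda>t. g (- t)) 0 x)\<^sup>2 * dens x) * indicator {0..} x"
  have "(\<integral>\<^sup>+x. ennreal ((antiderivative g x)\<^sup>2 * dens x) \<partial>lborel) \<le> (\<integral>\<^sup>+x. ?G x + ?H (- x) \<partial>lborel)"
    by (intro nn_integral_mono)
      (auto simp: antiderivative_def primitive_reflect dens_even split: split_indicator)
  also have "\<dots> = (\<integral>\<^sup>+x. ?G x \<partial>lborel) + (\<integral>\<^sup>+x. ?H (- x) \<partial>lborel)"
    by (rule nn_integral_add) measurable
  also have "(\<integral>\<^sup>+x. ?H (- x) \<partial>lborel) = (\<integral>\<^sup>+x. ?H x \<partial>lborel)"
    by (rule nn_integral_reflect) measurable
  also have "(\<integral>\<^sup>+x. ?G x \<partial>lborel) + (\<integral>\<^sup>+x. ?H x \<partial>lborel)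
    \<le> ennreal (1 / lam) * (\<integral>\<^sup>+t. ennreal ((g t)\<^sup>2 * dens t) * indicator {0..} t \<partial>lborel)
     + ennreal (1 / lam) * (\<integral>\<^sup>+t. ennreal ((g (- t))\<^sup>2 * dens t) * indicator {0..} t \<partial>lborel)"
    by (intro add_mono hardy_primitive[OF sup lam] g set_integrable_reflect) measurable
  also have "(\<integral>\<^sup>+t. ennreal ((g (- t))\<^sup>2 * dens t) * indicator {0..} t \<partial>lborel)
    = (\<integral>\<^sup>+t. ennreal ((g t)\<^sup>2 * dens t) * indicator {..0} t \<partial>lborel)"
    by (subst nn_integral_reflect[symmetric])
      (auto simp: dens_even intro!: nn_integral_cong split: split_indicator)
  also have "ennreal (1 / lam) * (\<integral>\<^sup>+t. ennreal ((g t)\<^sup>2 * dens t) * indicator {0..} t \<partial>lborel)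
     + ennreal (1 / lam) * (\<integral>\<^sup>+t. ennreal ((g t)\<^sup>2 * dens t) * indicator {..0} t \<partial>lborel)
     = ennreal (1 / lam) * (\<integral>\<^sup>+t. ennreal ((g t)\<^sup>2 * dens t) * indicator {0..} t + ennreal ((g t)\<^sup>2 * dens t) * indicator {..0} t \<partial>lborel)"
    by (subst nn_integral_add) (auto simp: distrib_left)
  also have "(\<integral>\<^sup>+t. ennreal ((g t)\<^sup>2 * dens t) * indicator {0..} t + ennreal ((g t)\<^sup>2 * dens t) * indicator {..0} t \<partial>lborel)
      = (\<integral>\<^sup>+t. ennreal ((g t)\<^sup>2 * dens t) \<partial>lborel)"
  proof (rule nn_integral_cong_AE)
    show "AE t in lborel. ennreal ((g t)\<^sup>2 * dens t) * indicator {0..} t + ennreal ((g t)\<^sup>2 * dens t) * indicator {..0} t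
      = ennreal ((g t)\<^sup>2 * dens t)"
      using AE_lborel_singleton[of 0] by eventually_elim (auto split: split_indicator)
  qed
  finally show ?thesis .
qed

section \<open>From half-line estimates to the normalised measure\<close>

lemma nu_eq: "nu 4 = density lborel (\<lambda>x. ennreal (dens x / Z 4))"
  by (simp add: nu_def dens_def)

lemma integral_nu:
  assumes "f \<in> borel_measurable borel"
  shows "(LINT x|nu 4. f x) = (LINT x|lborel. f x * dens x) / Z 4"
proof -
  have "(LINT x|nu 4. f x) = (LINT x|lborel. (dens x / Z 4) *\<^sub>R f x)"
    unfolding nu_eq using assms dens_pos Z_pos by (intro integral_density) (auto simp: less_imp_le)
  also have "\<dots> = (LINT x|lborel. f x * dens x / Z 4)"
    by (intro Bochner_Integration.integral_cong) auto
  finally show ?thesis by simp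
qed

lemma integrable_nu:
  assumes "f \<in> borel_measurable borel"
  shows "integrable (nu 4) f \<longleftrightarrow> integrable lborel (\<lambda>x. f x * dens x)"
proof -
  have "integrable (nu 4) f \<longleftrightarrow> integrable lborel (\<lambda>x. (dens x / Z 4) *\<^sub>R f x)"
    unfolding nu_eq using assms dens_pos Z_pos by (intro integrable_density) (auto simp: less_imp_le)
  also have "(\<lambda>x. (dens x / Z 4) *\<^sub>R f x) = (\<lambda>x. (1 / Z 4) * (f x * dens x))" by (auto simp: mult.commute)
  also have "integrable lborel \<dots> \<longleftrightarrow> integrable lborel (\<lambda>x. f x * dens x)"
    using Z_pos by (simp only: integrable_mult_left_iff) simp
  finally show ?thesis .
qed

lemma poincare_const_of_supersolution:
  assumes sup: "supersolution lam 0 A B" and lam: "0 < lam"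
  shows "poincare_const (nu 4) (1 / lam)"
  unfolding poincare_const_def
proof (intro allI impI)
  fix u g assume H: "H1 (nu 4) u g"
  then have [measurable]: "u \<in> borel_measurable borel" "g \<in> borel_measurable borel"
    and w: "weak_deriv u g" by (auto simp: H1_def)
  have u2: "integrable lborel (\<lambda>x. (u x)\<^sup>2 * dens x)" and g2: "integrable lborel (\<lambda>x. (g x)\<^sup>2 * dens x)"
    using H by (auto simp: H1_def integrable_nu)
  have u1: "integrable lborel (\<lambda>x. u x * dens x)"
  proof (rule Bochner_Integration.integrable_bound)
    show "integrable lborel (\<lambda>x. dens x + (u x)\<^sup>2 * dens x)"
      by (intro Bochner_Integration.integrable_add integrable_dens u2)
    show "AE x in lborel. norm (u x * dens x) \<le> norm (dens x + (u x)\<^sup>2 * dens x)"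
    proof (rule AE_I2)
      fix x
      \<comment> \<open>This yields \<bar>u\<bar> \<le> 1 / 4 + u^2, which reduces integrability of
        u to that of u^2 and of the density.\<close>
      have "0 \<le> (\<bar>u x\<bar> - 1 / 2)\<^sup>2" by simp
      then have "\<bar>u x\<bar> \<le> 1 + (u x)\<^sup>2" by (simp add: power2_eq_square algebra_simps)
      then have "\<bar>u x\<bar> * dens x \<le> (1 + (u x)\<^sup>2) * dens x"
        using dens_pos[of x] by (intro mult_right_mono) auto
      then show "norm (u x * dens x) \<le> norm (dens x + (u x)\<^sup>2 * dens x)"
        using dens_pos[of x] by (simp add: abs_mult algebra_simps)
    qed
  qed simp
  have g: "set_integrable lborel {a..b} g" for a b
    using w compact_Icc[of a b] unfolding weak_deriv_def by blast
  obtain c where c: "AE x in lborel. u x = c + antiderivative g x"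
    using weak_deriv_imp_antiderivative[OF w] by auto
  define z where "z = Z 4"
  have z: "0 < z" "(LINT x|lborel. dens x) = z" using Z_pos by (auto simp: z_def Z_eq)
  define a where "a = (LINT x|lborel. u x * dens x)"
  have i: "integrable lborel (\<lambda>x. (u x - c)\<^sup>2 * dens x)"
    and e: "(LINT x|lborel. (u x - c)\<^sup>2 * dens x) = (LINT x|lborel. (u x)\<^sup>2 * dens x) - 2 * c * a + c\<^sup>2 * z"
  proof -
    have *: "(\<lambda>x. (u x - c)\<^sup>2 * dens x) = (\<lambda>x. (u x)\<^sup>2 * dens x - 2 * c * (u x * dens x) + c\<^sup>2 * dens x)"
      by (auto simp: power2_eq_square algebra_simps)
    show "integrable lborel (\<lambda>x. (u x - c)\<^sup>2 * dens x)"
      unfolding * using u1 u2 integrable_dens by auto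
    show "(LINT x|lborel. (u x - c)\<^sup>2 * dens x) = (LINT x|lborel. (u x)\<^sup>2 * dens x) - 2 * c * a + c\<^sup>2 * z"
      unfolding * a_def z(2)[symmetric] using u1 u2 integrable_dens by simp
  qed
  have "ennreal (LINT x|lborel. (u x - c)\<^sup>2 * dens x) = (\<integral>\<^sup>+x. ennreal ((u x - c)\<^sup>2 * dens x) \<partial>lborel)"
    using dens_pos by (intro nn_integral_eq_integral[symmetric] i) (auto simp: less_imp_le)
  also have "\<dots> = (\<integral>\<^sup>+x. ennreal ((antiderivative g x)\<^sup>2 * dens x) \<partial>lborel)"
    by (rule nn_integral_cong_AE) (use c in \<open>eventually_elim, simp\<close>)
  also have "\<dots> \<le> ennreal (1 / lam) * (\<integral>\<^sup>+t. ennreal ((g t)\<^sup>2 * dens t) \<partial>lborel)"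
    by (rule hardy_antiderivative[OF sup lam g]) simp
  also have "(\<integral>\<^sup>+t. ennreal ((g t)\<^sup>2 * dens t) \<partial>lborel) = ennreal (LINT x|lborel. (g x)\<^sup>2 * dens x)"
    using dens_pos by (intro nn_integral_eq_integral g2) (auto simp: less_imp_le)
  also have "ennreal (1 / lam) * \<dots> = ennreal (1 / lam * (LINT x|lborel. (g x)\<^sup>2 * dens x))"
    using lam by (subst ennreal_mult') auto
  finally have "(LINT x|lborel. (u x - c)\<^sup>2 * dens x) \<le> 1 / lam * (LINT x|lborel. (g x)\<^sup>2 * dens x)"
    using lam dens_pos by (subst (asm) ennreal_le_iff) (auto simp: less_imp_le intro!: divide_nonneg_pos Bochner_Integration.integral_nonneg)
  then have main: "(LINT x|lborel. (u x)\<^sup>2 * dens x) - 2 * c * a + c\<^sup>2 * z \<le> 1 / lam * (LINT x|lborel. (g x)\<^sup>2 * dens x)"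
    by (simp add: e)
  \<comment> \<open>The mean of u is a / z, and this square is the amount by which the second moment
    about c exceeds the variance.\<close>
  have "0 \<le> (a / z - c)\<^sup>2" by simp
  then have "- (a / z)\<^sup>2 \<le> (- 2 * c * a + c\<^sup>2 * z) / z"
    using z(1) by (simp add: power2_eq_square field_simps)
  then have "(LINT x|lborel. (u x)\<^sup>2 * dens x) / z - (a / z)\<^sup>2
      \<le> ((LINT x|lborel. (u x)\<^sup>2 * dens x) - 2 * c * a + c\<^sup>2 * z) / z"
    by (simp add: add_divide_distrib diff_divide_distrib)
  also have "\<dots> \<le> (1 / lam * (LINT x|lborel. (g x)\<^sup>2 * dens x)) / z"
    using main z(1) by (intro divide_right_mono) auto
  finally show "(LINT x|nu 4. (u x)\<^sup>2) - (LINT x|nu 4. u x)\<^sup>2 \<le> 1 / lam * (LINT x|nu 4. (g x)\<^sup>2)"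
    by (simp add: integral_nu z_def a_def)
qed

lemma integral_even:
  fixes F :: "real \<Rightarrow> real"
  assumes F: "integrable lborel F" and even: "\<And>x. F (- x) = F x"
  shows "(LINT x|lborel. F x) = 2 * (LINT x:{0..}|lborel. F x)"
proof -
  have "(LINT x:{..0} \<union> {0..}|lborel. F x) = (LINT x:{..0}|lborel. F x) + (LINT x:{0..}|lborel. F x)"
    using integrable_mult_indicator[OF _ F]
    by (intro set_integral_split_point[where b = 0]) (auto simp: set_integrable_def)
  moreover have "{..0} \<union> {0..} = (UNIV :: real set)" by auto
  moreover have "(LINT x:{..0}|lborel. F x) = (LINT x:{0..}|lborel. F x)"
  proof -
    have "(LINT x:{..0}|lborel. F x) = (LINT x|lborel. indicator {..0} (- x) *\<^sub>R F (- x))"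
      unfolding set_lebesgue_integral_def
      using lborel_integral_real_affine[of "-1" "\<lambda>x. indicator {..0} x *\<^sub>R F x" 0] by simp
    also have "\<dots> = (LINT x:{0..}|lborel. F x)"
      unfolding set_lebesgue_integral_def
      by (intro Bochner_Integration.integral_cong) (auto simp: even split: split_indicator)
    finally show ?thesis .
  qed
  ultimately show ?thesis by (simp add: set_lebesgue_integral_def)
qed

text \<open>The odd extension has mean zero, so its variance is its second moment, and oddness
  doubles both half-line integrals. Writing S for the mass and E for the energy, S \<le> C * E \<le>
  C * lam * S, and S > 0 is divided out.\<close>

lemma poincare_const_ge_of_subsolution:
  assumes sub: "subsolution lam k 0 0 B" and k: "0 < k" and lam: "0 < lam"
    and C: "poincare_const (nu 4) C"
  shows "1 / lam \<le> C"
proof -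
  from sub obtain g M L where [measurable]: "g \<in> borel_measurable borel" and M0: "0 \<le> M"
    and L: "\<And>x. \<bar>g x\<bar> \<le> L" and M: "\<And>x. M \<le> x \<Longrightarrow> g x = 0"
    and fM': "\<And>y. 0 \<le> y \<Longrightarrow> \<forall>x\<ge>M. k \<le> y + primitive g 0 x"
    and energy': "\<And>y. 0 \<le> y \<Longrightarrow> (LINT x:{0..}|lborel. (g x)\<^sup>2 * dens x) + y * (B * dens 0)
      \<le> lam * (LINT x:{0..}|lborel. (y + primitive g 0 x)\<^sup>2 * dens x)"
    unfolding subsolution_def by blast
  \<comment> \<open>Taking y = 0 starts the test function at the origin and removes the boundary
    term, whatever the slope B is there.\<close>
  have fM: "k \<le> primitive g 0 x" if "M \<le> x" for x
    using fM'[of 0] that by simp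
  have energy: "(LINT x:{0..}|lborel. (g x)\<^sup>2 * dens x) \<le> lam * (LINT x:{0..}|lborel. (primitive g 0 x)\<^sup>2 * dens x)"
    using energy'[of 0] by simp
  define h where "h t = g \<bar>t\<bar>" for t
  have [measurable]: "h \<in> borel_measurable borel" unfolding h_def by simp
  have hL: "\<bar>h x\<bar> \<le> L" for x using L by (simp add: h_def)
  have hI: "set_integrable lborel {a..b} h" for a b by (rule set_integrable_bounded[OF _ hL]) simp
  define u where "u = antiderivative h"
  have [measurable]: "u \<in> borel_measurable borel" unfolding u_def by simp
  have prim: "primitive h 0 x = primitive g 0 x" for x
    unfolding primitive_def by (rule set_lebesgue_integral_cong) (auto simp: h_def)
  have hh: "(\<lambda>t. h (- t)) = h" by (rule ext) (simp add: h_def)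
  have u_pos: "u x = primitive g 0 x" if "0 \<le> x" for x
    using that by (simp add: u_def antiderivative_def prim)
  have u_neg: "u (- x) = - u x" for x
  proof -
    have "primitive h (- x) 0 = primitive h 0 x" for x
      using primitive_reflect[of h x] by (simp add: hh)
    note sym = this
    have "primitive h 0 0 = 0"
    proof -
      have "AE t in lborel. indicator {0..0} t *\<^sub>R h t = 0"
        using AE_lborel_singleton[of 0] by eventually_elim (auto split: split_indicator)
      then show ?thesis
        unfolding primitive_def set_lebesgue_integral_def by (rule integral_eq_zero_AE)
    qed
    then show ?thesis
      using sym[of x] sym[of "- x"] unfolding u_def antiderivative_def
      by (cases x "0::real" rule: linorder_cases) simp_all
  qed
  have uB: "\<bar>u x\<bar> \<le> L * M" for x
  proof -
    have "\<bar>u y\<bar> \<le> L * M" if "0 \<le> y" for y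
      using primitive_bounded[of g L M 0 y] L M M0 that by (simp add: u_pos)
    from this[of x] this[of "- x"] show ?thesis using u_neg[of x] by (cases "0 \<le> x") auto
  qed
  have int_u2: "integrable lborel (\<lambda>x. (u x)\<^sup>2 * dens x)"
  proof (rule integrable_bounded_dens)
    show "\<bar>(u x)\<^sup>2\<bar> \<le> (L * M)\<^sup>2" for x using power_mono[OF uB[of x], of 2] by simp
  qed measurable
  have int_h2: "integrable lborel (\<lambda>x. (h x)\<^sup>2 * dens x)"
  proof (rule integrable_bounded_dens)
    show "\<bar>(h x)\<^sup>2\<bar> \<le> L\<^sup>2" for x using power_mono[OF hL[of x], of 2] by simp
  qed measurable
  have "H1 (nu 4) u h"
    unfolding H1_def using int_u2 int_h2 weak_deriv_antiderivative[OF hI]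
    by (simp add: integrable_nu u_def)
  then have P: "(LINT x|nu 4. (u x)\<^sup>2) - (LINT x|nu 4. u x)\<^sup>2 \<le> C * (LINT x|nu 4. (h x)\<^sup>2)"
    using C unfolding poincare_const_def by blast
  have mean: "(LINT x|lborel. u x * dens x) = 0"
  proof -
    have "(LINT x|lborel. u x * dens x) = (LINT x|lborel. u (- x) * dens (- x))"
      using lborel_integral_real_affine[of "-1" "\<lambda>x. u x * dens x" 0] by simp
    also have "\<dots> = - (LINT x|lborel. u x * dens x)"
      by (simp add: u_neg dens_even)
    finally show ?thesis by simp
  qed
  define S where "S = (LINT x:{0..}|lborel. (primitive g 0 x)\<^sup>2 * dens x)"
  define E where "E = (LINT x:{0..}|lborel. (g x)\<^sup>2 * dens x)"
  have "(LINT x|lborel. (u x)\<^sup>2 * dens x) = 2 * (LINT x:{0..}|lborel. (u x)\<^sup>2 * dens x)"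
    by (rule integral_even[OF int_u2]) (simp add: u_neg dens_even)
  also have "(LINT x:{0..}|lborel. (u x)\<^sup>2 * dens x) = S"
    unfolding S_def by (rule set_lebesgue_integral_cong) (auto simp: u_pos)
  finally have u2: "(LINT x|lborel. (u x)\<^sup>2 * dens x) = 2 * S" .
  have "(LINT x|lborel. (h x)\<^sup>2 * dens x) = 2 * (LINT x:{0..}|lborel. (h x)\<^sup>2 * dens x)"
    by (rule integral_even[OF int_h2]) (simp add: h_def dens_even)
  also have "(LINT x:{0..}|lborel. (h x)\<^sup>2 * dens x) = E"
    unfolding E_def by (rule set_lebesgue_integral_cong) (auto simp: h_def)
  finally have h2: "(LINT x|lborel. (h x)\<^sup>2 * dens x) = 2 * E" .
  have "2 * S / Z 4 \<le> C * (2 * E / Z 4)"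
    using P by (simp add: integral_nu mean u2 h2)
  then have SE: "S \<le> C * E"
    using Z_pos by (simp add: field_simps)
  have E0: "0 \<le> E"
    unfolding E_def set_lebesgue_integral_def by (simp add: dens_pos less_imp_le)
  have S0: "0 \<le> S"
    unfolding S_def set_lebesgue_integral_def by (simp add: dens_pos less_imp_le)
  \<comment> \<open>Beyond M the test function is at least k > 0, so it cannot vanish almost
    everywhere on [M, M + 1].\<close>
  have "S \<noteq> 0"
  proof
    assume "S = 0"
    then have "(LINT x|lborel. (u x)\<^sup>2 * dens x) = 0" using u2 by simp
    then have "AE x in lborel. (u x)\<^sup>2 * dens x = 0"
      using integral_nonneg_eq_0_iff_AE[OF int_u2] by (simp add: dens_pos less_imp_le)
    then have "AE x in lborel. x \<notin> {M..M + 1}"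
    proof eventually_elim
      case (elim x)
      then have "u x = 0" using dens_pos[of x] by simp
      then show ?case using fM[of x] k M0 u_pos[of x] by auto
    qed
    then have "{M..M + 1} \<in> null_sets lborel" by (subst AE_iff_null_sets) auto
    then show False by (simp add: null_sets_def)
  qed
  then have S: "0 < S" using S0 by simp
  have "0 < C"
  proof (rule ccontr)
    assume "\<not> 0 < C"
    then have "C * E \<le> 0" using E0 by (intro mult_nonpos_nonneg) auto
    then show False using SE S by simp
  qed
  then have "C * E \<le> C * (lam * S)"
    using energy by (intro mult_left_mono) (auto simp: S_def E_def)
  then have "1 * S \<le> (C * lam) * S" using SE by (simp add: mult.assoc)
  then have "1 \<le> C * lam" using S mult_le_cancel_right_pos by blast
  then show ?thesis using lam by (simp add: field_simps)
qed

text \<open>The infimum of the admissible constants is itself admissible: for a fixed pair the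
  inequality reads W \<le> C * D. If D = 0 it does not depend on C, and otherwise W / D is a lower
  bound for all admissible C.\<close>

lemma least_poincare_const:
  assumes hi: "poincare_const M hi" and lo: "\<And>C. poincare_const M C \<Longrightarrow> lo \<le> C"
  shows "\<exists>C. poincare_const M C \<and> (\<forall>C'. poincare_const M C' \<longrightarrow> C \<le> C') \<and> C \<in> {lo..hi}"
proof -
  define S where "S = {C. poincare_const M C}"
  have bdd: "bdd_below S" by (rule bdd_belowI[of _ lo]) (simp add: S_def lo)
  have ne: "S \<noteq> {}" using hi by (auto simp: S_def)
  have "poincare_const M (Inf S)"
    unfolding poincare_const_def
  proof (intro allI impI)
    fix u g assume H: "H1 M u g"
    define D where "D = (LINT x|M. (g x)\<^sup>2)"
    define W where "W = (LINT x|M. (u x)\<^sup>2) - (LINT x|M. u x)\<^sup>2"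
    have W: "W \<le> C * D" if "C \<in> S" for C
      using that H by (simp add: S_def poincare_const_def D_def W_def)
    have "0 \<le> D" by (simp add: D_def)
    then consider "D = 0" | "0 < D" by linarith
    then have "W \<le> Inf S * D"
    proof cases
      case 1
      then show ?thesis using W[of hi] hi by (simp add: S_def)
    next
      case 2
      then have "W / D \<le> Inf S"
        using W by (intro cInf_greatest[OF ne]) (simp add: field_simps)
      then show ?thesis using 2 by (simp add: field_simps)
    qed
    then show "(LINT x|M. (u x)\<^sup>2) - (LINT x|M. u x)\<^sup>2 \<le> Inf S * (LINT x|M. (g x)\<^sup>2)"
      by (simp add: W_def D_def)
  qed
  moreover have "Inf S \<le> C'" if "poincare_const M C'" for C'
    using that bdd by (intro cInf_lower) (auto simp: S_def)
  ultimately show ?thesis using hi lo by (intro exI[of _ "Inf S"]) auto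
qed

section \<open>Piecewise polynomial certificates\<close>

fun poly_add :: "int list \<Rightarrow> int list \<Rightarrow> int list" where
  "poly_add [] q = q"
| "poly_add p [] = p"
| "poly_add (a # p) (b # q) = (a + b) # poly_add p q"

fun poly_mul :: "int list \<Rightarrow> int list \<Rightarrow> int list" where
  "poly_mul [] q = []"
| "poly_mul (a # p) q = poly_add (map ((*) a) q) (0 # poly_mul p q)"

fun poly_deriv :: "int list \<Rightarrow> int list" where
  "poly_deriv [] = []"
| "poly_deriv (a # p) = poly_add p (0 # poly_deriv p)"

definition poly_eval :: "int list \<Rightarrow> 'a::comm_ring_1 \<Rightarrow> 'a" where
  "poly_eval p y = foldr (\<lambda>a r. of_int a + y * r) p 0"

text \<open>The l1 norm of the coefficients dominates the sup norm on [- 1, 1]; the sign checks rest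
  on this bound, so no subdivision of a piece is involved.\<close>

definition abs_sum :: "int list \<Rightarrow> int" where
  "abs_sum p = sum_list (map abs p)"

text \<open>
  A list \<open>p\<close> represents a piece \<open>P x = poly_eval p (16 * x - m)\<close> centred at \<open>m / 16\<close>, with local variable
  in \<open>[- 1, 1]\<close>. The residual is \<open>256 * d * (P'' - V' P' + (n / d) P)\<close>, which has integer coefficients
  because \<open>4096 * V' = (m + y) ^ 3 - 1024 * (m + y)\<close> for \<open>x = (m + y) / 16\<close>.
\<close>

definition residual :: "int \<Rightarrow> int \<Rightarrow> int \<Rightarrow> int list \<Rightarrow> int list" where
  "residual d n m p =
     poly_add (map ((*) (65536 * d)) (poly_deriv (poly_deriv p)))
       (poly_add (map ((*) (- d))
           (poly_mul [m * m * m - 1024 * m, 3 * (m * m) - 1024, 3 * m, 1] (poly_deriv p)))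
         (map ((*) (256 * n)) p))"

fun dominated :: "int list \<Rightarrow> bool" where
  "dominated [] = True"
| "dominated (a # p) = (a + abs_sum p \<le> 0)"

text \<open>
  The first piece (\<open>m = 0\<close>) only uses the half \<open>0 \<le> y\<close>; there the residual vanishes at 0, so a factor
  \<open>y\<close> is split off before comparing coefficients.
\<close>

fun nonpos_cert :: "int \<Rightarrow> int list \<Rightarrow> bool" where
  "nonpos_cert m [] = True"
| "nonpos_cert m (a # p) = (if m = 0 then a \<le> 0 \<and> dominated p else dominated (a # p))"

fun pos_cert :: "int list \<Rightarrow> bool" where
  "pos_cert [] = False"
| "pos_cert (a # p) = (abs_sum p < a)"

text \<open>Neighbouring centres are 2 / 16 apart, so the point y = 1 of one piece is y = - 1 of the
  next. Both local variables have the same scale, hence slopes may be compared in y; exact equality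
  of integers leaves no gap at the joint.\<close>

definition joins :: "int list \<Rightarrow> int list \<Rightarrow> bool" where
  "joins p q \<longleftrightarrow> poly_eval p (1::int) = poly_eval q (-1) \<and>
     poly_eval (poly_deriv p) (1::int) = poly_eval (poly_deriv q) (-1)"

text \<open>Here lam = n / d. The closing test is the entry condition of the linear tail at R = (m +
  1) / 16: the first part says R \<ge> 2, the second is lam * A \<le> B * V' R after multiplication
  by 4096 * d, where the factor 16 turns the slope in y into the slope in x.\<close>

fun super_chain :: "int \<Rightarrow> int \<Rightarrow> int \<Rightarrow> int list list \<Rightarrow> bool" where
  "super_chain d n m [] = False"
| "super_chain d n m (p # ps) = (
     nonpos_cert m (residual d n m p) \<and> nonpos_cert m (map uminus p) \<and> pos_cert (poly_deriv p) \<and>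
     (case ps of
        [] \<Rightarrow> 32 \<le> m + 1 \<and> 4096 * n * poly_eval p 1 \<le>
          16 * d * ((m + 1) * (m + 1) * (m + 1) - 1024 * (m + 1)) * poly_eval (poly_deriv p) 1
      | q # _ \<Rightarrow> joins p q \<and> super_chain d n (m + 2) ps))"

text \<open>The residual is negated because the differential inequality points the other way. The
  closing test is the entry condition of the constant tail, with a strictly positive value that
  becomes \<open>k\<close>.\<close>

fun sub_chain :: "int \<Rightarrow> int \<Rightarrow> int \<Rightarrow> int list list \<Rightarrow> bool" where
  "sub_chain d n m [] = False"
| "sub_chain d n m (p # ps) = (
     nonpos_cert m (map uminus (residual d n m p)) \<and> nonpos_cert m (map uminus p) \<and>
     (case ps of
        [] \<Rightarrow> 0 < poly_eval p (1::int) \<and> poly_eval (poly_deriv p) (1::int) \<le> 0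
      | q # _ \<Rightarrow> joins p q \<and> sub_chain d n (m + 2) ps))"

section \<open>Soundness of the integer checks\<close>

lemma poly_eval_simps [simp]:
  "poly_eval [] y = 0" "poly_eval (a # p) y = of_int a + y * poly_eval p y"
  by (simp_all add: poly_eval_def)

lemma poly_eval_add: "poly_eval (poly_add p q) y = poly_eval p y + poly_eval q y"
  by (induction p q rule: poly_add.induct) (simp_all add: algebra_simps)

lemma poly_eval_smult: "poly_eval (map ((*) a) p) y = of_int a * poly_eval p y"
  by (induction p) (simp_all add: algebra_simps)

lemma poly_eval_uminus: "poly_eval (map uminus p) y = - poly_eval p y"
  by (induction p) (simp_all add: algebra_simps)

lemma poly_eval_mul: "poly_eval (poly_mul p q) y = poly_eval p y * poly_eval q y"
  by (induction p) (simp_all add: poly_eval_add poly_eval_smult algebra_simps)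

lemma poly_eval_of_int: "poly_eval p (of_int y) = of_int (poly_eval p y)"
  by (induction p) simp_all

lemma DERIV_poly_eval:
  fixes y :: real
  shows "(poly_eval p has_real_derivative poly_eval (poly_deriv p) y) (at y)"
proof (induction p)
  case Nil
  have "poly_eval [] = (\<lambda>_::real. 0)" by (rule ext) simp
  then show ?case by simp
next
  case (Cons a p)
  have *: "poly_eval (a # p) = (\<lambda>y::real. of_int a + y * poly_eval p y)" by (rule ext) simp
  show ?case
    unfolding * by (auto intro!: derivative_eq_intros Cons simp: poly_eval_add algebra_simps)
qed

lemma poly_eval_le_abs_sum:
  fixes y :: real
  assumes "\<bar>y\<bar> \<le> 1"
  shows "\<bar>poly_eval p y\<bar> \<le> of_int (abs_sum p)"
proof (induction p)
  case (Cons a p)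
  have "\<bar>y * poly_eval p y\<bar> \<le> 1 * \<bar>poly_eval p y\<bar>"
    unfolding abs_mult using assms by (intro mult_right_mono) auto
  then show ?case using Cons by (simp add: abs_sum_def)
qed (simp add: abs_sum_def)

lemma abs_mult_poly_eval_le:
  fixes y :: real
  assumes "\<bar>y\<bar> \<le> 1"
  shows "\<bar>y * poly_eval p y\<bar> \<le> of_int (abs_sum p)"
proof -
  have "\<bar>y * poly_eval p y\<bar> \<le> 1 * \<bar>poly_eval p y\<bar>"
    unfolding abs_mult using assms by (intro mult_right_mono) auto
  then show ?thesis using poly_eval_le_abs_sum[OF assms, of p] by simp
qed

lemma dominated_nonpos:
  fixes y :: real
  assumes "dominated p" "\<bar>y\<bar> \<le> 1"
  shows "poly_eval p y \<le> 0"
proof (cases p)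
  case (Cons a q)
  then have "real_of_int (a + abs_sum q) \<le> 0" using assms(1) by (simp only: of_int_le_0_iff dominated.simps)
  then show ?thesis using abs_mult_poly_eval_le[OF assms(2), of q] Cons by simp
qed simp

text \<open>The piece centred at the origin is cut at its centre, so that the chain begins exactly
  at x = 0.\<close>

definition left_end :: "int \<Rightarrow> int" where
  "left_end m = (if m = 0 then 0 else - 1)"

lemma nonpos_cert_sound:
  fixes y :: real
  assumes "nonpos_cert m p" "left_end m \<le> y" "y \<le> 1"
  shows "poly_eval p y \<le> 0"
proof (cases p)
  case (Cons a q)
  show ?thesis
  proof (cases "m = 0")
    case True
    then have "y * poly_eval q y \<le> 0"
      using assms Cons by (intro mult_nonneg_nonpos dominated_nonpos) (auto simp: left_end_def)
    moreover have "real_of_int a \<le> 0" using assms Cons True by simp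
    ultimately show ?thesis using Cons by simp
  next
    case False
    then show ?thesis
      using assms Cons by (intro dominated_nonpos) (auto simp: left_end_def)
  qed
qed simp

lemma pos_cert_sound:
  fixes y :: real
  assumes "pos_cert p" "\<bar>y\<bar> \<le> 1"
  shows "0 < poly_eval p y"
proof (cases p)
  case (Cons a q)
  then have "real_of_int (abs_sum q) < real_of_int a" using assms(1) by simp
  then show ?thesis using abs_mult_poly_eval_le[OF assms(2), of q] Cons by simp
qed (use assms in simp)

context
  fixes m :: int and p :: "int list" and P P' P'' :: "real \<Rightarrow> real"
  defines "P \<equiv> \<lambda>x::real. poly_eval p (16 * x - m)"
    and "P' \<equiv> \<lambda>x::real. 16 * poly_eval (poly_deriv p) (16 * x - m)"
    and "P'' \<equiv> \<lambda>x::real. 256 * poly_eval (poly_deriv (poly_deriv p)) (16 * x - m)"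
begin

lemma DERIV_piece:
  fixes x :: real
  shows
  "(P has_real_derivative P' x) (at x)" "(P' has_real_derivative P'' x) (at x)" "isCont P'' x"
proof -
  have aff: "((\<lambda>x. 16 * x - real_of_int m) has_real_derivative 16) (at x)" for x
    by (auto intro!: derivative_eq_intros)
  have D: "((\<lambda>x. poly_eval q (16 * x - m)) has_real_derivative poly_eval (poly_deriv q) (16 * x - m) * 16) (at x)" for q and x :: real
    by (rule DERIV_chain2[OF DERIV_poly_eval aff])
  show "(P has_real_derivative P' x) (at x)"
    using D[of p x] by (simp add: P_def P'_def mult.commute)
  show "(P' has_real_derivative P'' x) (at x)"
    using DERIV_cmult[OF D[of "poly_deriv p" x], of 16] by (simp add: P'_def P''_def mult.commute)
  show "isCont P'' x"
    unfolding P''_def by (intro continuous_intros DERIV_isCont[OF D])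
qed

lemma residual_eq:
  fixes x :: real
  assumes "0 < d"
  shows "256 * real_of_int d * (P'' x - (x ^ 3 - 4 * x) * P' x + n / d * P x) = poly_eval (residual d n m p) (16 * x - m)"
proof -
  define y where "y = 16 * x - m"
  have x: "x = (m + y) / 16" by (simp add: y_def)
  show ?thesis
    unfolding P_def P'_def P''_def residual_def y_def[symmetric] poly_eval_add poly_eval_mul poly_eval_smult x
    using assms by (simp add: field_simps power3_eq_cube)
qed

end

text \<open>Recursion on the list matches gluing from the right: the empty remainder is the linear
  tail, and each head is attached to the supersolution that the induction hypothesis provides for
  the remaining pieces.\<close>

lemma super_chain_sound:
  assumes "super_chain d n m ps" "0 < d" "0 \<le> n" "n \<le> d" "0 \<le> m"
  shows "supersolution (n / d) ((m + left_end m) / 16) (poly_eval (hd ps) (of_int (left_end m)))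
    (16 * poly_eval (poly_deriv (hd ps)) (of_int (left_end m)))"
  using assms
proof (induction d n m ps rule: super_chain.induct)
  case (2 d n m p ps)
  define P where "P x = poly_eval p (16 * x - m)" for x :: real
  define P' where "P' x = 16 * poly_eval (poly_deriv p) (16 * x - m)" for x :: real
  define P'' where "P'' x = 256 * poly_eval (poly_deriv (poly_deriv p)) (16 * x - m)" for x :: real
  note D = DERIV_piece[where p = p and m = m, folded P_def P'_def P''_def]
  define a where "a = (m + left_end m) / 16"
  define b where "b = (m + 1) / 16"
  have range: "left_end m \<le> 16 * x - m" "16 * x - m \<le> 1" "\<bar>16 * x - m\<bar> \<le> 1" if "a \<le> x" "x \<le> b" for x :: real
    using that by (auto simp: a_def b_def left_end_def split: if_splits)
  have scaled_ends: "16 * a - m = left_end m" "16 * b - m = 1"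
    by (simp_all add: a_def b_def add_divide_distrib)
  have ends: "P a = poly_eval p (of_int (left_end m))" "P' a = 16 * poly_eval (poly_deriv p) (of_int (left_end m))"
    "P b = poly_eval p 1" "P' b = 16 * poly_eval (poly_deriv p) 1"
    by (simp_all add: P_def P'_def scaled_ends)
  have res: "nonpos_cert m (residual d n m p)" and nn: "nonpos_cert m (map uminus p)" and pos: "pos_cert (poly_deriv p)"
    using 2 by auto
  have lam: "0 \<le> n / d" "n / d \<le> (1::real)" using 2 by auto
  have nonneg: "0 \<le> P x" if "a \<le> x" "x \<le> b" for x :: real
    using nonpos_cert_sound[OF nn range(1,2)[OF that]] by (simp add: P_def poly_eval_uminus)
  have P'pos: "0 < P' x" if "a \<le> x" "x \<le> b" for x :: real
    using pos_cert_sound[OF pos range(3)[OF that]] by (simp add: P'_def)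
  have ineq: "P'' x - (x ^ 3 - 4 * x) * P' x + n / d * P x \<le> 0" if "a \<le> x" "x \<le> b" for x :: real
  proof -
    have "256 * real_of_int d * (P'' x - (x ^ 3 - 4 * x) * P' x + n / d * P x) \<le> 0"
      using nonpos_cert_sound[OF res range(1,2)[OF that]]
      unfolding P_def P'_def P''_def residual_eq[OF \<open>0 < d\<close>] .
    then show ?thesis using \<open>0 < d\<close> by (simp add: mult_le_0_iff)
  qed
  have ab: "a < b" by (simp add: a_def b_def left_end_def)
  have "supersolution (n / d) b (P b) (P' b)"
  proof (cases ps)
    case Nil
    show ?thesis
    proof (rule supersolution_tail[OF lam])
      show "2 \<le> b" using 2 Nil by (simp add: b_def)
      show "0 \<le> P b" "0 < P' b" using nonneg P'pos ab by auto
      have "4096 * n * poly_eval p 1 \<le>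
          16 * d * ((m + 1) * (m + 1) * (m + 1) - 1024 * (m + 1)) * poly_eval (poly_deriv p) 1"
        using 2 Nil by simp
      then have "real_of_int (4096 * n * poly_eval p 1) \<le>
          real_of_int (16 * d * ((m + 1) * (m + 1) * (m + 1) - 1024 * (m + 1)) * poly_eval (poly_deriv p) 1)"
        by (simp only: of_int_le_iff)
      then show "n / d * P b \<le> P' b * (b ^ 3 - 4 * b)"
        using \<open>0 < d\<close> poly_eval_of_int[of p 1, where 'a = real] poly_eval_of_int[of "poly_deriv p" 1, where 'a = real]
        unfolding ends by (simp add: b_def field_simps power3_eq_cube)
    qed
  next
    case (Cons q qs)
    have join: "joins p q" and chain: "super_chain d n (m + 2) (q # qs)" using 2 Cons by auto
    have "supersolution (n / d) ((m + 2 + left_end (m + 2)) / 16) (poly_eval q (of_int (left_end (m + 2))))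
        (16 * poly_eval (poly_deriv q) (of_int (left_end (m + 2))))"
      using "2.IH"[OF Cons] chain 2 Cons by simp
    \<comment> \<open>Since m \<ge> 0, only the very first piece can be the truncated one; all later
      pieces start at y = - 1, where \<open>joins\<close> compares them.\<close>
    moreover have "left_end (m + 2) = - 1" using 2 by (simp add: left_end_def)
    moreover have "poly_eval q (- 1 :: real) = poly_eval p 1" "poly_eval (poly_deriv q) (- 1 :: real) = poly_eval (poly_deriv p) 1"
      using join poly_eval_of_int[of _ 1, where 'a = real] poly_eval_of_int[of _ "- 1", where 'a = real]
      by (simp_all add: joins_def)
    ultimately show ?thesis unfolding ends by (simp add: b_def add.commute)
  qed
  then have "supersolution (n / d) a (P a) (P' a)"
    by (rule supersolution_step[OF _ lam(1) ab D nonneg P'pos ineq refl refl])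
  then show ?case unfolding ends by (simp add: a_def)
qed simp

text \<open>The constant \<open>k\<close> is fixed by the tail and survives each gluing step
  unchanged, so one positive k serves the whole chain.\<close>

lemma sub_chain_sound:
  assumes "sub_chain d n m ps" "0 < d" "0 \<le> n" "0 \<le> m"
  shows "\<exists>k>0. subsolution (n / d) k ((m + left_end m) / 16) (poly_eval (hd ps) (of_int (left_end m)))
    (16 * poly_eval (poly_deriv (hd ps)) (of_int (left_end m)))"
  using assms
proof (induction d n m ps rule: sub_chain.induct)
  case (2 d n m p ps)
  define P where "P x = poly_eval p (16 * x - m)" for x :: real
  define P' where "P' x = 16 * poly_eval (poly_deriv p) (16 * x - m)" for x :: real
  define P'' where "P'' x = 256 * poly_eval (poly_deriv (poly_deriv p)) (16 * x - m)" for x :: real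
  note D = DERIV_piece[where p = p and m = m, folded P_def P'_def P''_def]
  define a where "a = (m + left_end m) / 16"
  define b where "b = (m + 1) / 16"
  have range: "left_end m \<le> 16 * x - m" "16 * x - m \<le> 1" if "a \<le> x" "x \<le> b" for x :: real
    using that by (auto simp: a_def b_def left_end_def split: if_splits)
  have scaled_ends: "16 * a - m = left_end m" "16 * b - m = 1"
    by (simp_all add: a_def b_def add_divide_distrib)
  have ends: "P a = poly_eval p (of_int (left_end m))" "P' a = 16 * poly_eval (poly_deriv p) (of_int (left_end m))"
    "P b = poly_eval p 1" "P' b = 16 * poly_eval (poly_deriv p) 1"
    by (simp_all add: P_def P'_def scaled_ends)
  have res: "nonpos_cert m (map uminus (residual d n m p))" and nn: "nonpos_cert m (map uminus p)"
    using 2 by auto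
  have lam: "0 \<le> n / d" using 2 by auto
  have nonneg: "0 \<le> P x" if "a \<le> x" "x \<le> b" for x :: real
    using nonpos_cert_sound[OF nn range[OF that]] by (simp add: P_def poly_eval_uminus)
  have ineq: "0 \<le> P'' x - (x ^ 3 - 4 * x) * P' x + n / d * P x" if "a \<le> x" "x \<le> b" for x :: real
  proof -
    have "0 \<le> 256 * real_of_int d * (P'' x - (x ^ 3 - 4 * x) * P' x + n / d * P x)"
      using nonpos_cert_sound[OF res range[OF that]]
      unfolding P_def P'_def P''_def residual_eq[OF \<open>0 < d\<close>] by (simp add: poly_eval_uminus)
    then show ?thesis using \<open>0 < d\<close> by (simp add: zero_le_mult_iff)
  qed
  have ab: "a < b" by (simp add: a_def b_def left_end_def)
  have "\<exists>k>0. subsolution (n / d) k b (P b) (P' b)"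
  proof (cases ps)
    case Nil
    then have "0 < poly_eval p (1::int)" "poly_eval (poly_deriv p) (1::int) \<le> 0" using 2 by auto
    then have "0 < P b" "P' b \<le> 0"
      using poly_eval_of_int[of p 1, where 'a = real] poly_eval_of_int[of "poly_deriv p" 1, where 'a = real]
      unfolding ends by simp_all
    then show ?thesis using subsolution_tail[OF lam, of "P b" "P' b" b] by auto
  next
    case (Cons q qs)
    have join: "joins p q" and chain: "sub_chain d n (m + 2) (q # qs)" using 2 Cons by auto
    have "\<exists>k>0. subsolution (n / d) k ((m + 2 + left_end (m + 2)) / 16) (poly_eval q (of_int (left_end (m + 2))))
        (16 * poly_eval (poly_deriv q) (of_int (left_end (m + 2))))"
      using "2.IH"[OF Cons] chain 2 Cons by simp
    moreover have "left_end (m + 2) = - 1" using 2 by (simp add: left_end_def)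
    moreover have "poly_eval q (- 1 :: real) = poly_eval p 1" "poly_eval (poly_deriv q) (- 1 :: real) = poly_eval (poly_deriv p) 1"
      using join poly_eval_of_int[of _ 1, where 'a = real] poly_eval_of_int[of _ "- 1", where 'a = real]
      by (simp_all add: joins_def)
    ultimately show ?thesis unfolding ends by (simp add: b_def add.commute)
  qed
  then obtain k where k: "0 < k" "subsolution (n / d) k b (P b) (P' b)" by blast
  have "subsolution (n / d) k a (P a) (P' a)"
    by (rule subsolution_step[OF k(2) lam ab D nonneg ineq refl refl])
  then show ?case using k(1) unfolding ends by (auto simp: a_def)
qed simp

section \<open>Numerical data and the resulting bounds\<close>

text \<open>
  Coefficients in units of \<open>10 ^ -18\<close> of local Taylor expansions of the solution of
  \<open>f'' - V' f' + f / C = 0\<close>, \<open>f 0 = 0\<close>, \<open>f' 0 = 1\<close>: with \<open>C = 33.5800425\<close> for the supersolution, slightly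
  below the upper bound to be proved, and with \<open>C = 33.580042194\<close> for the subsolution, between the lower
  bound \<open>33.58004219\<close> and the true value \<open>33.580042199...\<close>. The two lowest coefficients of each piece are
  adjusted so that values and derivatives agree exactly at the joints.
\<close>

definition super_cert :: "int list list" where
  "super_cert =
    [[0, 62500000000000000, 0, -163972151409607, 0, 432947161300, 0, -985247848, 0, 1957046, 0, -3461],
     [123701951981124241, 60566533035298092, -949850300612507, -147195627242801, 4061348852998, 354031222627,
      -12528301249, -721110416, 30880286, 1256522, -64217, -1902],
     [239933476778218242, 55156375644934028, -1710660229889572, -102890897998177, 6686776385794, 158924214537,
      -18557463130, -114632386, 40417241, -224892, -72683, 1108],
     [342691341770933970, 47302160854687454, -2159269279274391, -46002945906294, 7173917081294, -56284067333,
      -16008687830, 438188940, 25491117, -1278402, -27064, 2621],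
     [428402581760126906, 38335256696937515, -2271123741114661, 6859525949403, 5796390116502, -202878920091,
      -7930697942, 649589016, 972391, -1272481, 24248],
     [496129301721742119, 29501096741512761, -2108554178155691, 44205686756675, 3469991605079, -245372620172,
      519851212, 512373789, -15893244, -542339, 42045],
     [547098686478634297, 21689070235209877, -1779231491094348, 62490059512538, 1171487979556, -203977960801,
      5685163021, 218448575, -18641565, 185655, 27117],
     [583872425133911914, 15344365245077380, -1391014691334675, 64702764956681, -485828014414, -125197203409,
      6855233111, -32850586, -11867700, 487986, 3738],
     [609503371163467063, 10532467855425333, -1022869569163807, 56868071730357, -1346993759260, -50021202602,
      5394570108, -153075072, -3420515, 405896, -9651],
     [626908945573530870, 7077265503270742, -716803231958838, 44864577151078, -1568726271597, 1056990051,
      3105732742, -159609627, 1933339, 185644, -10778],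
     [638530293388913376, 4698839969392555, -484538321855843, 32768886274635, -1413727160922, 26077008884,
      1178808221, -111355755, 3578204, 12963, -6128],
     [646230248067250682, 3110940317872024, -319553804540282, 22634797064559, -1109420802348, 32455471791,
      12134056, -56908138, 3007118, -61200],
     [651338273933116513, 2071417403245642, -207804921225248, 15032763850634, -796966413173, 29035975710,
      -492191869, -18416078, 1791787, -66160],
     [654758295422229983, 1397309772723562, -134540239959005, 9732276146266, -539542980904, 22259210900,
      -590731775, 1635091, 780731, -44547],
     [657084654404809528, 960339503189305, -87454346800040, 6213877513189, -351225894489, 15577451577, -506311181,
      8849996, 188254, -22297],
     [658700074674795337, 675002512650250, -57469629732244, 3951345630863, -223219383093, 10291455101, -373462941,
      9443987, -70937, -7921],
     [659848547048110328, 486152874995533, -38378947657775, 2522620810726, -140173478175, 6559101711, -253029181,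
      7577240, -141585],
     [660685469829075465, 358902377809812, -26138549042699, 1627099801734, -87802434596, 4095383068, -162847593,
      5335892, -131249],
     [661310453628236414, 271362325170276, -18191303216226, 1065201990231, -55265550310, 2534099280, -101668541,
      3493769, -97947],
     [661788125440321752, 209795715476349, -12945955898724, 709965822646, -35148461149, 1567480741, -62466999,
      2192376, -65822],
     [662161096824929910, 165521054088951, -9417955322139, 482600546905, -22675480912, 975539634, -38164847,
      1343650, -41702],
     [662457994045068944, 132986101181709, -6996846923140, 334795240903, -14876285976, 613805185, -23351192,
      816029, -25360],
     [662698437446704584, 108585177466636, -5301100019827, 237016292435, -9936394855, 392177642, -14304773, 508045,
      -13269],
     [662896152245812721, 89935851824345, -4089213328408, 171188645275, -6742067283, 259065896, -8019513, 461138,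
      15755],
     [663060936574737801, 75436936553452, -3204726726071, 126649889751, -4459894699, 223228489, 6039251, 2400536,
      378368, 61720, 9224],
     [663199941360350210, 64015802355117, -2529821952006, 103445909004, -307303146, 933312851, 192222809, 41945601,
      8129501, 1457740, 243215, 38077, 5629],
     [663318727051366855, 55271949571973, -1741814377637, 221294150110, 53330120378, 17434245975, 4693079469,
      1130459441, 246500859, 49344099, 9161145, 1590535, 259973, 40227, 5920],
     [663426032815223608, 55909464222992, 4993282163203, 3691929564782, 1548444962464, 549317229275, 167972019759,
      45483218110, 11106998298, 2480208863, 511916534, 98505641, 17795782, 3035934, 491489, 75822, 11187, 1583]]"

definition sub_cert :: "int list list" where
  "sub_cert =
    [[0, 62500000000000000, 0, -163972151420649, 0, 432947161334, 0, -985247848, 0, 1957046, 0, -3461, 0, 6],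
     [123701951981038370, 60566533035169798, -949850300676048, -147195627252506, 4061348853320, 354031222654,
      -12528301250, -721110416, 30880286, 1256522, -64217, -1902, 117],
     [239933476777552616, 55156375644449997, -1710660230001771, -102890898004407, 6686776386313, 158924214548,
      -18557463131, -114632386, 40417241, -224892, -72683, 1108, 111],
     [342691341768811536, 47302160853698149, -2159269279411156, -46002945908204, 7173917081826, -56284067340,
      -16008687831, 438188940, 25491117, -1278402, -27064, 2621],
     [428402581755453719, 38335256695374612, -2271123741251034, 6859525951252, 5796390116891, -202878920110,
      -7930697942, 649589016, 972391, -1272481, 24248, 1721, -71],
     [496129301713437926, 29501096739455780, -2108554178273151, 44205686760811, 3469991605258, -245372620193,
      519851212, 512373789, -15893244, -542339, 42045, -80, -66],
     [547098686465790565, 21689070232747076, -1779231491184207, 62490059517306, 1171487979544, -203977960817,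
      5685163022, 218448575, -18641565, 185655, 27117, -1067],
     [583872425115816928, 15344365242309082, -1391014691397369, 64702764960801, -485828014551, -125197203418,
      6855233112, -32850586, -11867700, 487986, 3738, -911],
     [609503371139607248, 10532467852443934, -1022869569205655, 56868071733113, -1346993759453, -50021202605,
      5394570108, -153075072, -3420515, 405896, -9651, -296],
     [626908945543554831, 7077265500143919, -716803231988929, 44864577152230, -1568726271799, 1056990051,
      3105732742, -159609627, 1933339, 185644, -10778, 137],
     [638530293352568572, 4698839966151636, -484538321883828, 32768886274195, -1413727161118, 26077008884,
      1178808220, -111355755, 3578204, 12963, -6128, 239],
     [646230248024292381, 3110940314492573, -319553804575596, 22634797062549, -1109420802549, 32455471789,
      12134056, -56908138, 3007118, -61200, -1594, 159],
     [651338273883232111, 2071417399692142, -207804921275477, 15032763846709, -796966413409, 29035975702,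
      -492191870, -18416079, 1791787, -66160, 720],
     [654758295365020151, 1397309768931282, -134540240040077, 9732276140109, -539542981263, 22259210883,
      -590731776, 1635091, 780731, -44547, 1228],
     [657084654339655772, 960339499004756, -87454346929496, 6213877503361, -351225895113, 15577451540, -506311184,
      8849996, 188254, -22297, 935],
     [658700074600678918, 675002507819688, -57469629939811, 3951345614154, -223219384287, 10291455018, -373462946,
      9443987, -70937, -7921, 513],
     [659848546963361554, 486152869103515, -38378948002575, 2522620780012, -140173480685, 6559101512, -253029196,
      7577239, -141585, -928, 213],
     [660685469730850779, 358902370050251, -26138549652374, 1627099739761, -87802440443, 4095382541, -162847638,
      5335888, -131250, 1557],
     [661310453511444324, 271362313984935, -18191304394261, 1065201850386, -55265565635, 2534097703, -101668693,
      3493755, -97949, 1935],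
     [661788125295027193, 209795697250259, -12945958458602, 709965461948, -35148507259, 1567475307, -62467596,
      2192314, -65828, 1580],
     [662161096629105496, 165521019239344, -9417961785863, 482599455523, -22675644157, 975517520, -38167603,
      1343331, -41737, 1102],
     [662457993741416479, 132986019672434, -6996866582631, 334791250030, -14876985390, 613696042, -23366676,
      814002, -25608, 710],
     [662698436853454931, 108584934095825, -5301174843229, 236998064703, -9940135535, 391504816, -14413576, 491945,
      -15477, 433],
     [662896150629525609, 89934885625629, -4089583859864, 171080914173, -6767893509, 253715932, -9005656, 296136,
      -9670, 204],
     [663060930004419091, 75431639898757, -3207209496284, 125794815040, -4698425509, 166435897, -5881475, 145884,
      -11976, -874, -159],
     [663199900594415002, 63974225629910, -2553229674004, 93975506930, -3366667326, 98575476, -6931363, -587158,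
      -139545, -24318, -4076, -638, -94],
     [663318336645822246, 54787341562415, -2064785145919, 69060620231, -3316778245, -213975581, -81016919,
      -18859129, -4130165, -826298, -153421, -26636, -4354, -674, -99],
     [663420135440964333, 47202291691764, -1793441854784, -5681569574, -27702420399, -9145115993, -2814596542,
      -761650838, -186007625, -41535454, -8572949, -1649651, -298022, -50842, -8231, -1270, -187],
     [663506224424469321, 37100564977577, -5114227548942, -2286202859344, -1132538906941, -453916161786,
      -156434390725, -47521492858, -12969190531, -3225468817, -739193113, -157495409, -31424926, -5907381, -1051566,
      -178026, -28771, -4453, -662, -95],
     [663486684609105542, -162214456114376, -206557365988469, -146325824630068, -80554704991092, -36455623344873,
      -14107690094782, -4794638239679, -1459012815199, -403373795704, -102482951230, -24146539415, -5315674270,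
      -1100164108, -215192249, -39958452, -7071000, -1196478, -194162, -30297, -4556, -662, -93]]"

text \<open>With lam = 1 / 33.58004265, smaller than the 1 / 33.5800425 of the data, the exact
  solution has a negative residual where it is positive, and this margin covers the rounding. The 28
  pieces reach R = 55 / 16, where the slope is large enough for the linear tail.\<close>

lemma super_cert: "super_chain 3358004265 (10 ^ 8) 0 super_cert"
  by code_simp

text \<open>Now lam = 1 / 33.58004219 exceeds the 1 / 33.580042194 of the data, so the residual is
  positive away from 0. The two constants differ by only 4e-9, hence the many digits. The slope
  changes sign inside the last piece, which ends at 59 / 16.\<close>

lemma sub_cert: "sub_chain 3358004219 (10 ^ 8) 0 sub_cert"
  by code_simp

text \<open>The odd extension is continuous only if the test function starts at exactly 0, which the
  chain conditions by themselves do not force.\<close>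

lemma sub_cert_hd: "poly_eval (hd sub_cert) 0 = 0"
  by (simp add: sub_cert_def)

theorem mainTheorem13:
  shows "\<exists>C. poincare_const (nu 4) C \<and> (\<forall>C'. poincare_const (nu 4) C' \<longrightarrow> C \<le> C') \<and>
             C \<in> {33.58004242 - 2.3 / 10 ^ 7 .. 33.58004242 + 2.3 / 10 ^ 7}"
proof (rule least_poincare_const)
  \<comment> \<open>The denominators 3358004265 here and 3358004219 below are the two endpoints of
    the claimed interval times 10^8, so the resulting constants are these endpoints exactly.\<close>
  obtain A B where "supersolution (10 ^ 8 / 3358004265) 0 A B"
    using super_chain_sound[OF super_cert] by (auto simp: left_end_def)
  then have "poincare_const (nu 4) (1 / (10 ^ 8 / 3358004265))"
    by (rule poincare_const_of_supersolution) simp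
  then show "poincare_const (nu 4) (33.58004242 + 2.3 / 10 ^ 7)" by simp
next
  fix C assume C: "poincare_const (nu 4) C"
  obtain k B where "0 < k" "subsolution (10 ^ 8 / 3358004219) k 0 0 B"
    using sub_chain_sound[OF sub_cert] by (auto simp: left_end_def sub_cert_hd)
  then have "1 / (10 ^ 8 / 3358004219) \<le> C"
    by (intro poincare_const_ge_of_subsolution[OF _ _ _ C]) auto
  then show "33.58004242 - 2.3 / 10 ^ 7 \<le> C" by simp
qed

end
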